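(* Let $M:=\mathbb{R}^{2p}$ with coordinates $(x_1,\dots,x_p,y_1,\dots,y_p)$, let $f$ be a smooth real-valued function of $x\in\mathbb{R}^p$, and let $g_f$ be the metric $$ds_f^2:=\sum_i dx^i\circ dy^i+\sum_{i,j}\frac{\partial f}{\partial x_i}\frac{\partial f}{\partial x_j}\,dx^i\circ dx^j$$ on $M$. Let $L_{\mathcal X}$ be the quadratic form on the distribution $\mathcal{X}=\mathrm{span}\{\partial_1^x,\dots,\partial_p^x\}$ given by $L_{\mathcal X}(\partial_i^x,\partial_j^x)=\frac{\partial^2 f}{\partial x_i\partial x_j}$. Assume $L_{\mathcal X}$ is non-degenerate (at every point of $M$). (1) If $p=2$, or if $p\ge3$ and $L_{\mathcal X}$ is definite, then $(M,g_f)$ is: (a) nilpotent Jordan Osserman; (b) nilpotent spacelike and timelike Jordan IP; (c) not mixed Jordan IP. (2) If $p\ge3$ and $L_{\mathcal X}$ is indefinite, then $(M,g_f)$ is: (a) neither spacelike Jordan Osserman nor timelike Jordan Osserman; (b) nilpotent spacelike and timelike Jordan IP; (c) not mixed Jordan IP.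
   Context: The notation for $g_f$ means: $(\partial_i^x,\partial_j^x)=\frac{\partial f}{\partial x_i}\frac{\partial f}{\partial x_j}$, $(\partial_i^x,\partial_j^y)=\delta_{ij}$, $(\partial_i^y,\partial_j^y)=0$, where $\partial_i^x=\partial/\partial x_i$, $\partial_i^y=\partial/\partial y_i$. This metric has signature $(p,p)$. ($L_{\mathcal X}$ is the restriction to $\mathcal X$ of the second fundamental form of $(M,g_f)$ realized as a hypersurface in a flat space of signature $(p,p+1)$.) For a pseudo-Riemannian manifold $(M,g)$ with Levi-Civita connection $\nabla$, the curvature is $R(Z_1,Z_2)=\nabla_{Z_1}\nabla_{Z_2}-\nabla_{Z_2}\nabla_{Z_1}-\nabla_{[Z_1,Z_2]}$. The Jacobi operator is $J(X):Y\mapsto R(Y,X)X$. For a non-degenerate oriented $2$-plane $\pi$ in a tangent space with oriented orthonormal basis $\{X_1,X_2\}$, the skew-symmetric curvature operator is $\mathcal{R}(\pi):Y\mapsto R(X_1,X_2)Y$. A non-degenerate $2$-plane is spacelike, timelike or mixed if the induced metric is positive definite, negative definite or of signature $(1,1)$ respectively. Let $S^\pm(M,g):=\{X\in TM:(X,X)=\pm1\}$. "Jordan normal form" means real Jordan normal form, i.e. conjugacy class. $(M,g)$ is spacelike (resp. timelike) Jordan Osserman if the Jordan normal form of $J(X)$ is constant for $X\in S^+(M,g)$ (resp. $X\in S^-(M,g)$); Jordan Osserman means both. $(M,g)$ is spacelike (resp. timelike, mixed) Jordan IP if the Jordan normal form of $\mathcal{R}(\pi)$ is constant as $\pi$ ranges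 over all oriented spacelike (resp. timelike, mixed) $2$-planes in $TM$. The adjective "nilpotent" means additionally that the only complex eigenvalue of the operator in question is $0$: $J(X)$ for all tangent vectors $X$ (Osserman), $\mathcal{R}(\pi)$ for all oriented non-degenerate $2$-planes $\pi$ (IP). *)

theory Defs
  imports "HOL-Analysis.Analysis"
begin

text \<open>
  All manifolds here are a Euclidean space \<open>'a\<close> with its global chart: every tangent space is
  identified with \<open>'a\<close>, vector fields are functions \<open>'a \<Rightarrow> 'a\<close>, and a metric is a function
  \<open>'a \<Rightarrow> 'a \<Rightarrow> 'a \<Rightarrow> real\<close> taking a point and two tangent vectors at that point.
\<close>

subsection \<open>Smooth functions\<close>

primrec differentiable_upto ::
  "nat \<Rightarrow> ('a::euclidean_space \<Rightarrow> 'b::euclidean_space) \<Rightarrow> bool" where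
  "differentiable_upto 0 h \<longleftrightarrow> continuous_on UNIV h"
| "differentiable_upto (Suc k) h \<longleftrightarrow>
     (\<forall>P. h differentiable (at P)) \<and>
     (\<forall>v. differentiable_upto k (\<lambda>P. frechet_derivative h (at P) v))"

definition smooth :: "('a::euclidean_space \<Rightarrow> 'b::euclidean_space) \<Rightarrow> bool" where
  "smooth h \<longleftrightarrow> (\<forall>k. differentiable_upto k h)"


subsection \<open>Bilinear forms on subspaces\<close>

definition nondegenerate_on :: "('a::real_vector \<Rightarrow> 'a \<Rightarrow> real) \<Rightarrow> 'a set \<Rightarrow> bool" where
  "nondegenerate_on B S \<longleftrightarrow> (\<forall>u\<in>S. u \<noteq> 0 \<longrightarrow> (\<exists>v\<in>S. B u v \<noteq> 0))"

definition positive_definite_on :: "('a::real_vector \<Rightarrow> 'a \<Rightarrow> real) \<Rightarrow> 'a set \<Rightarrow> bool" where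
  "positive_definite_on B S \<longleftrightarrow> (\<forall>u\<in>S. u \<noteq> 0 \<longrightarrow> B u u > 0)"

definition negative_definite_on :: "('a::real_vector \<Rightarrow> 'a \<Rightarrow> real) \<Rightarrow> 'a set \<Rightarrow> bool" where
  "negative_definite_on B S \<longleftrightarrow> (\<forall>u\<in>S. u \<noteq> 0 \<longrightarrow> B u u < 0)"

definition definite_on :: "('a::real_vector \<Rightarrow> 'a \<Rightarrow> real) \<Rightarrow> 'a set \<Rightarrow> bool" where
  "definite_on B S \<longleftrightarrow> positive_definite_on B S \<or> negative_definite_on B S"

definition indefinite_on :: "('a::real_vector \<Rightarrow> 'a \<Rightarrow> real) \<Rightarrow> 'a set \<Rightarrow> bool" where
  "indefinite_on B S \<longleftrightarrow> (\<exists>u\<in>S. B u u > 0) \<and> (\<exists>v\<in>S. B v v < 0)"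


subsection \<open>Levi-Civita connection and curvature\<close>

definition directional_derivative ::
  "('a::euclidean_space \<Rightarrow> 'a) \<Rightarrow> ('a \<Rightarrow> 'b::euclidean_space) \<Rightarrow> 'a \<Rightarrow> 'b" where
  "directional_derivative X h P = frechet_derivative h (at P) (X P)"

definition lie_bracket ::
  "('a::euclidean_space \<Rightarrow> 'a) \<Rightarrow> ('a \<Rightarrow> 'a) \<Rightarrow> 'a \<Rightarrow> 'a" where
  "lie_bracket X Y P = directional_derivative X Y P - directional_derivative Y X P"

definition affine_connection ::
  "(('a::euclidean_space \<Rightarrow> 'a) \<Rightarrow> ('a \<Rightarrow> 'a) \<Rightarrow> ('a \<Rightarrow> 'a)) \<Rightarrow> bool" where
  "affine_connection D \<longleftrightarrow>
     (\<forall>X Y. smooth X \<and> smooth Y \<longrightarrow> smooth (D X Y)) \<and>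
     (\<forall>X X' Y. smooth X \<and> smooth X' \<and> smooth Y \<longrightarrow>
        D (\<lambda>P. X P + X' P) Y = (\<lambda>P. D X Y P + D X' Y P)) \<and>
     (\<forall>h X Y. smooth (h :: 'a \<Rightarrow> real) \<and> smooth X \<and> smooth Y \<longrightarrow>
        D (\<lambda>P. h P *\<^sub>R X P) Y = (\<lambda>P. h P *\<^sub>R D X Y P)) \<and>
     (\<forall>X Y Y'. smooth X \<and> smooth Y \<and> smooth Y' \<longrightarrow>
        D X (\<lambda>P. Y P + Y' P) = (\<lambda>P. D X Y P + D X Y' P)) \<and>
     (\<forall>h X Y. smooth (h :: 'a \<Rightarrow> real) \<and> smooth X \<and> smooth Y \<longrightarrow>
        D X (\<lambda>P. h P *\<^sub>R Y P) =
          (\<lambda>P. directional_derivative X h P *\<^sub>R Y P + h P *\<^sub>R D X Y P))"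

definition torsion_free ::
  "(('a::euclidean_space \<Rightarrow> 'a) \<Rightarrow> ('a \<Rightarrow> 'a) \<Rightarrow> ('a \<Rightarrow> 'a)) \<Rightarrow> bool" where
  "torsion_free D \<longleftrightarrow>
     (\<forall>X Y. smooth X \<and> smooth Y \<longrightarrow> (\<forall>P. D X Y P - D Y X P = lie_bracket X Y P))"

definition metric_compatible ::
  "('a::euclidean_space \<Rightarrow> 'a \<Rightarrow> 'a \<Rightarrow> real) \<Rightarrow>
   (('a \<Rightarrow> 'a) \<Rightarrow> ('a \<Rightarrow> 'a) \<Rightarrow> ('a \<Rightarrow> 'a)) \<Rightarrow> bool" where
  "metric_compatible g D \<longleftrightarrow>
     (\<forall>X Y Z. smooth X \<and> smooth Y \<and> smooth Z \<longrightarrow>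
        (\<forall>P. directional_derivative X (\<lambda>Q. g Q (Y Q) (Z Q)) P =
             g P (D X Y P) (Z P) + g P (Y P) (D X Z P)))"

text \<open>
  For a pseudo-Riemannian metric the connection with these properties exists and is unique on smooth
  vector fields.  The choice operator (rather than a definite description) is used because its
  values on non-smooth arguments, which are never used, are unconstrained.
\<close>
definition levi_civita ::
  "('a::euclidean_space \<Rightarrow> 'a \<Rightarrow> 'a \<Rightarrow> real) \<Rightarrow> ('a \<Rightarrow> 'a) \<Rightarrow> ('a \<Rightarrow> 'a) \<Rightarrow> ('a \<Rightarrow> 'a)" where
  "levi_civita g = (SOME D. affine_connection D \<and> torsion_free D \<and> metric_compatible g D)"

definition curvature ::
  "('a::euclidean_space \<Rightarrow> 'a \<Rightarrow> 'a \<Rightarrow> real) \<Rightarrow>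
   ('a \<Rightarrow> 'a) \<Rightarrow> ('a \<Rightarrow> 'a) \<Rightarrow> ('a \<Rightarrow> 'a) \<Rightarrow> ('a \<Rightarrow> 'a)" where
  "curvature g Z1 Z2 Z3 = (let D = levi_civita g in
     (\<lambda>P. D Z1 (D Z2 Z3) P - D Z2 (D Z1 Z3) P - D (lie_bracket Z1 Z2) Z3 P))"

text \<open>
  The curvature is a tensor, so its value on tangent vectors at \<open>P\<close> may be computed with any
  smooth extensions; here the extensions with constant coordinates are taken.
\<close>
definition curvature_at ::
  "('a::euclidean_space \<Rightarrow> 'a \<Rightarrow> 'a \<Rightarrow> real) \<Rightarrow> 'a \<Rightarrow> 'a \<Rightarrow> 'a \<Rightarrow> 'a \<Rightarrow> 'a" where
  "curvature_at g P u v w = curvature g (\<lambda>_. u) (\<lambda>_. v) (\<lambda>_. w) P"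

definition jacobi_operator ::
  "('a::euclidean_space \<Rightarrow> 'a \<Rightarrow> 'a \<Rightarrow> real) \<Rightarrow> 'a \<Rightarrow> 'a \<Rightarrow> 'a \<Rightarrow> 'a" where
  "jacobi_operator g P X = (\<lambda>Y. curvature_at g P Y X X)"

definition skew_operator ::
  "('a::euclidean_space \<Rightarrow> 'a \<Rightarrow> 'a \<Rightarrow> real) \<Rightarrow> 'a \<Rightarrow> 'a \<Rightarrow> 'a \<Rightarrow> 'a \<Rightarrow> 'a" where
  "skew_operator g P X1 X2 = (\<lambda>Y. curvature_at g P X1 X2 Y)"


subsection \<open>Jordan normal forms and eigenvalues of real operators\<close>

definition same_jordan_form ::
  "('a::euclidean_space \<Rightarrow> 'a) \<Rightarrow> ('a \<Rightarrow> 'a) \<Rightarrow> bool" where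
  "same_jordan_form A B \<longleftrightarrow> (\<exists>\<phi>. linear \<phi> \<and> bij \<phi> \<and> \<phi> \<circ> A = B \<circ> \<phi>)"

definition constant_jordan_form :: "('a::euclidean_space \<Rightarrow> 'a) set \<Rightarrow> bool" where
  "constant_jordan_form \<A> \<longleftrightarrow> (\<forall>A\<in>\<A>. \<forall>B\<in>\<A>. same_jordan_form A B)"

text \<open>
  Real and imaginary part of \<open>A (u + \<i> v) = z (u + \<i> v)\<close> for the complexification of \<open>A\<close>.
\<close>
definition complex_eigenvalues :: "('a::euclidean_space \<Rightarrow> 'a) \<Rightarrow> complex set" where
  "complex_eigenvalues A = {z. \<exists>u v. (u \<noteq> 0 \<or> v \<noteq> 0) \<and>
     A u = Re z *\<^sub>R u - Im z *\<^sub>R v \<and> A v = Im z *\<^sub>R u + Re z *\<^sub>R v}"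


subsection \<open>The Jordan Osserman property\<close>

definition spacelike_jordan_osserman ::
  "('a::euclidean_space \<Rightarrow> 'a \<Rightarrow> 'a \<Rightarrow> real) \<Rightarrow> bool" where
  "spacelike_jordan_osserman g \<longleftrightarrow>
     constant_jordan_form {jacobi_operator g P X | P X. g P X X = 1}"

definition timelike_jordan_osserman ::
  "('a::euclidean_space \<Rightarrow> 'a \<Rightarrow> 'a \<Rightarrow> real) \<Rightarrow> bool" where
  "timelike_jordan_osserman g \<longleftrightarrow>
     constant_jordan_form {jacobi_operator g P X | P X. g P X X = - 1}"

definition jordan_osserman ::
  "('a::euclidean_space \<Rightarrow> 'a \<Rightarrow> 'a \<Rightarrow> real) \<Rightarrow> bool" where
  "jordan_osserman g \<longleftrightarrow> spacelike_jordan_osserman g \<and> timelike_jordan_osserman g"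

definition nilpotent_osserman ::
  "('a::euclidean_space \<Rightarrow> 'a \<Rightarrow> 'a \<Rightarrow> real) \<Rightarrow> bool" where
  "nilpotent_osserman g \<longleftrightarrow> (\<forall>P X. complex_eigenvalues (jacobi_operator g P X) = {0})"


subsection \<open>The Jordan IP property\<close>

definition two_plane :: "'a::euclidean_space set \<Rightarrow> bool" where
  "two_plane \<pi> \<longleftrightarrow> subspace \<pi> \<and> dim \<pi> = 2"

definition spacelike_plane ::
  "('a::euclidean_space \<Rightarrow> 'a \<Rightarrow> 'a \<Rightarrow> real) \<Rightarrow> 'a \<Rightarrow> 'a set \<Rightarrow> bool" where
  "spacelike_plane g P \<pi> \<longleftrightarrow> two_plane \<pi> \<and> positive_definite_on (g P) \<pi>"

definition timelike_plane ::
  "('a::euclidean_space \<Rightarrow> 'a \<Rightarrow> 'a \<Rightarrow> real) \<Rightarrow> 'a \<Rightarrow> 'a set \<Rightarrow> bool" where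
  "timelike_plane g P \<pi> \<longleftrightarrow> two_plane \<pi> \<and> negative_definite_on (g P) \<pi>"

definition mixed_plane ::
  "('a::euclidean_space \<Rightarrow> 'a \<Rightarrow> 'a \<Rightarrow> real) \<Rightarrow> 'a \<Rightarrow> 'a set \<Rightarrow> bool" where
  "mixed_plane g P \<pi> \<longleftrightarrow> two_plane \<pi> \<and>
     (\<exists>e1 e2. span {e1, e2} = \<pi> \<and> g P e1 e1 = 1 \<and> g P e2 e2 = - 1 \<and> g P e1 e2 = 0)"

definition nondegenerate_plane ::
  "('a::euclidean_space \<Rightarrow> 'a \<Rightarrow> 'a \<Rightarrow> real) \<Rightarrow> 'a \<Rightarrow> 'a set \<Rightarrow> bool" where
  "nondegenerate_plane g P \<pi> \<longleftrightarrow> two_plane \<pi> \<and> nondegenerate_on (g P) \<pi>"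

definition orthonormal_basis ::
  "('a::euclidean_space \<Rightarrow> 'a \<Rightarrow> 'a \<Rightarrow> real) \<Rightarrow> 'a \<Rightarrow> 'a set \<Rightarrow> 'a \<Rightarrow> 'a \<Rightarrow> bool" where
  "orthonormal_basis g P \<pi> X1 X2 \<longleftrightarrow> span {X1, X2} = \<pi> \<and>
     g P X1 X1 \<in> {1, - 1} \<and> g P X2 X2 \<in> {1, - 1} \<and> g P X1 X2 = 0"

text \<open>
  The operators \<open>\<R>(\<pi>)\<close> for all oriented planes \<open>\<pi>\<close> of the kind \<open>K\<close>.  An ordered
  orthonormal basis is an oriented one for exactly one of the two orientations of its span, and
  \<open>\<R>(\<pi>)\<close> is the same for all oriented orthonormal bases of an oriented plane; so the oriented
  planes are ranged over by letting \<open>(X1, X2)\<close> range over all ordered orthonormal bases of all planes.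
\<close>
definition skew_operators ::
  "('a::euclidean_space \<Rightarrow> 'a \<Rightarrow> 'a \<Rightarrow> real) \<Rightarrow> ('a \<Rightarrow> 'a set \<Rightarrow> bool) \<Rightarrow> ('a \<Rightarrow> 'a) set" where
  "skew_operators g K =
     {skew_operator g P X1 X2 | P \<pi> X1 X2. K P \<pi> \<and> orthonormal_basis g P \<pi> X1 X2}"

definition spacelike_jordan_IP :: "('a::euclidean_space \<Rightarrow> 'a \<Rightarrow> 'a \<Rightarrow> real) \<Rightarrow> bool" where
  "spacelike_jordan_IP g \<longleftrightarrow> constant_jordan_form (skew_operators g (spacelike_plane g))"

definition timelike_jordan_IP :: "('a::euclidean_space \<Rightarrow> 'a \<Rightarrow> 'a \<Rightarrow> real) \<Rightarrow> bool" where
  "timelike_jordan_IP g \<longleftrightarrow> constant_jordan_form (skew_operators g (timelike_plane g))"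

definition mixed_jordan_IP :: "('a::euclidean_space \<Rightarrow> 'a \<Rightarrow> 'a \<Rightarrow> real) \<Rightarrow> bool" where
  "mixed_jordan_IP g \<longleftrightarrow> constant_jordan_form (skew_operators g (mixed_plane g))"

definition nilpotent_IP :: "('a::euclidean_space \<Rightarrow> 'a \<Rightarrow> 'a \<Rightarrow> real) \<Rightarrow> bool" where
  "nilpotent_IP g \<longleftrightarrow>
     (\<forall>A \<in> skew_operators g (nondegenerate_plane g). complex_eigenvalues A = {0})"


subsection \<open>The metric and the form on the distribution\<close>

definition partial :: "'p::finite \<Rightarrow> (real^'p \<Rightarrow> real) \<Rightarrow> real^'p \<Rightarrow> real" where
  "partial i h x = frechet_derivative h (at x) (axis i 1)"

text \<open>
  A point of \<open>M\<close> is a pair \<open>(x, y)\<close>, and a tangent vector is the pair of its coefficients with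
  respect to the fields \<open>\<partial>/\<partial>x\<^sub>i\<close> and \<open>\<partial>/\<partial>y\<^sub>i\<close>.  The normalisation of the metric is
  \<open>(\<partial>/\<partial>x\<^sub>i, \<partial>/\<partial>y\<^sub>j) = \<delta>\<^sub>i\<^sub>j\<close>, without a factor 1/2.
\<close>
definition metric_f ::
  "(real^'p::finite \<Rightarrow> real) \<Rightarrow>
   (real^'p) \<times> (real^'p) \<Rightarrow> (real^'p) \<times> (real^'p) \<Rightarrow> (real^'p) \<times> (real^'p) \<Rightarrow> real" where
  "metric_f f P u v =
     (\<Sum>i\<in>UNIV. fst u $ i * snd v $ i + snd u $ i * fst v $ i) +
     (\<Sum>i\<in>UNIV. \<Sum>j\<in>UNIV.
        partial i f (fst P) * partial j f (fst P) * (fst u $ i * fst v $ j))"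

definition distribution_X :: "((real^'p::finite) \<times> (real^'p)) set" where
  "distribution_X = span (range (\<lambda>i. (axis i 1, 0)))"

definition form_L ::
  "(real^'p::finite \<Rightarrow> real) \<Rightarrow>
   (real^'p) \<times> (real^'p) \<Rightarrow> (real^'p) \<times> (real^'p) \<Rightarrow> (real^'p) \<times> (real^'p) \<Rightarrow> real" where
  "form_L f P u v =
     (\<Sum>i\<in>UNIV. \<Sum>j\<in>UNIV. partial i (partial j f) (fst P) * (fst u $ i * fst v $ j))"

end

theory Submission
  imports Defs
begin

text \<open>
  Write \<open>H\<close> for the Hessian of \<open>f\<close> at \<open>x\<close>, seen as a symmetric linear map of the coordinate space,
  and \<open>u\<^sub>1\<close> for the \<open>x\<close>-part of a tangent vector \<open>u\<close>.  The metric depends on \<open>x\<close> only, and only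
  through the products \<open>f\<^sub>i f\<^sub>j\<close>.  The fields \<open>\<partial>/\<partial>y\<^sub>k\<close> are parallel, and the Christoffel symbols cancel
  down to the vertical vectors \<open>\<nabla>\<^sub>i \<partial>\<^sub>j = f\<^sub>i\<^sub>j \<Sum>\<^sub>k f\<^sub>k \<partial>/\<partial>y\<^sub>k\<close> for the fields \<open>\<partial>\<^sub>i = \<partial>/\<partial>x\<^sub>i\<close>.  Differentiating once more, the third derivatives of \<open>f\<close> drop out by
  symmetry and the curvature is the one given by a Gauss equation
  (\<open>curvature_at_metric_f\<close>):
  \<open>R(u, v) w = (0, (H v\<^sub>1 \<bullet> w\<^sub>1) H u\<^sub>1 - (H u\<^sub>1 \<bullet> w\<^sub>1) H v\<^sub>1)\<close>.
  To identify this connection with the chosen Levi-Civita connection one needs uniqueness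
  (\<open>levi_civita_unique\<close>).

  So every Jacobi operator and every skew-symmetric curvature operator has the form
  \<open>(a, b) \<mapsto> (0, T a)\<close>.  Such an operator has square zero, which gives nilpotency at once, and its
  conjugacy class is determined by \<open>dim (ker T)\<close> (\<open>same_jordan_form_vertical\<close>).  Everything is thereby
  reduced to counting dimensions, with \<open>H\<close> non-degenerate.

  For the Jacobi operator of \<open>X\<close> put \<open>x = X\<^sub>1\<close>; it is nonzero if \<open>X\<close> is not null.  The kernel of
  \<open>T y = (H x \<bullet> x) H y - (H y \<bullet> x) H x\<close> is the line through \<open>x\<close> if \<open>H x \<bullet> x \<noteq> 0\<close>, and the hyperplane
  orthogonal to \<open>H x\<close> otherwise.  For \<open>p = 2\<close> both have dimension 1; if \<open>H\<close> is definite the second case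
  never occurs; if \<open>p \<ge> 3\<close> and \<open>H\<close> is indefinite both occur, with different dimensions, and every
  nonzero \<open>x\<close> lifts to spacelike and to timelike unit vectors.

  For the curvature operator of a plane with orthonormal basis \<open>X\<^sub>1, X\<^sub>2\<close> the kernel has dimension
  \<open>p - 2\<close> if the \<open>x\<close>-parts of \<open>X\<^sub>1\<close> and \<open>X\<^sub>2\<close> are independent, and the operator vanishes otherwise.
  Vertical vectors are null, so on a definite plane the \<open>x\<close>-parts are always independent, whereas mixed
  planes of both kinds exist.
\<close>

section \<open>Calculus of smooth maps\<close>

lemma frechet_derivative_eqI:
  "(h has_derivative h') (at P) \<Longrightarrow> frechet_derivative h (at P) = h'"
  by (metis frechet_derivative_at)

text \<open>
  The recursion only records that the first derivatives are \<open>k\<close> times differentiable.  The product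
  rule also involves the undifferentiated factors, and for these the hypothesis has to be lowered
  from \<open>Suc k\<close> to \<open>k\<close>.
\<close>
lemma differentiable_upto_Suc_D:
  "differentiable_upto (Suc k) h \<Longrightarrow> differentiable_upto k h"
proof (induction k arbitrary: h)
  case 0
  then show ?case
    by (simp add: differentiable_imp_continuous_within continuous_at_imp_continuous_on)
next
  case (Suc k)
  then show ?case by (metis differentiable_upto.simps(2))
qed

lemma differentiable_upto_const: "differentiable_upto k (\<lambda>_. c)"
  by (induction k arbitrary: c) (simp_all add: frechet_derivative_eqI[OF has_derivative_const])

lemma differentiable_upto_add:
  "differentiable_upto k g \<Longrightarrow> differentiable_upto k h \<Longrightarrow> differentiable_upto k (\<lambda>P. g P + h P)"
proof (induction k arbitrary: g h)
  case 0
  then show ?case by (simp add: continuous_on_add)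
next
  case (Suc k)
  then show ?case
    by (simp add: frechet_derivative_eqI[OF has_derivative_add[OF frechet_derivative_works[THEN iffD1]
        frechet_derivative_works[THEN iffD1]]])
qed

lemma differentiable_upto_bilinear:
  assumes "bounded_bilinear m"
  shows "differentiable_upto k g \<Longrightarrow> differentiable_upto k h \<Longrightarrow>
    differentiable_upto k (\<lambda>P. m (g P) (h P))"
proof (induction k arbitrary: g h)
  case 0
  then show ?case by (simp add: bounded_bilinear.continuous_on[OF assms])
next
  case (Suc k)
  have g: "g differentiable (at P)" and h: "h differentiable (at P)" for P
    using Suc.prems by auto
  have d: "((\<lambda>P. m (g P) (h P)) has_derivative (\<lambda>v. m (g P) (frechet_derivative h (at P) v) +
      m (frechet_derivative g (at P) v) (h P))) (at P)" for P
    by (rule bounded_bilinear.FDERIV[OF assms frechet_derivative_works[THEN iffD1, OF g]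
          frechet_derivative_works[THEN iffD1, OF h]])
  have "differentiable_upto k (\<lambda>P. m (g P) (frechet_derivative h (at P) v) +
      m (frechet_derivative g (at P) v) (h P))" for v
    using Suc.prems differentiable_upto_Suc_D[OF Suc.prems(1)] differentiable_upto_Suc_D[OF Suc.prems(2)]
    by (intro differentiable_upto_add Suc.IH) auto
  then show ?case
    using d by (auto simp: frechet_derivative_eqI[OF d] differentiable_def)
qed

lemma differentiable_upto_compose_linear:
  assumes "bounded_linear L"
  shows "differentiable_upto k h \<Longrightarrow> differentiable_upto k (\<lambda>P. h (L P))"
proof (induction k arbitrary: h)
  case 0
  then show ?case
    using continuous_on_compose2[of UNIV h UNIV L] linear_continuous_on[OF assms] by simp
next
  case (Suc k)
  have "h differentiable (at P)" for P
    using Suc.prems by auto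
  then have d: "((\<lambda>P. h (L P)) has_derivative (\<lambda>v. frechet_derivative h (at (L P)) (L v))) (at P)" for P
    using has_derivative_compose[OF bounded_linear_imp_has_derivative[OF assms]]
      frechet_derivative_works by blast
  show ?case
    using d Suc.prems by (auto simp: frechet_derivative_eqI[OF d] differentiable_def intro!: Suc.IH)
qed

named_theorems smooth_intros

lemma smooth_const [smooth_intros]: "smooth (\<lambda>_. c)"
  by (simp add: smooth_def differentiable_upto_const)

lemma smooth_add [smooth_intros]: "smooth g \<Longrightarrow> smooth h \<Longrightarrow> smooth (\<lambda>P. g P + h P)"
  by (simp add: smooth_def differentiable_upto_add)

lemma smooth_bilinear:
  "bounded_bilinear m \<Longrightarrow> smooth g \<Longrightarrow> smooth h \<Longrightarrow> smooth (\<lambda>P. m (g P) (h P))"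
  by (simp add: smooth_def differentiable_upto_bilinear)

lemmas smooth_scaleR [smooth_intros] = smooth_bilinear[OF bounded_bilinear_scaleR]
lemmas smooth_inner [smooth_intros] = smooth_bilinear[OF bounded_bilinear_inner]

lemma smooth_sum [smooth_intros]:
  "(\<And>i. i \<in> I \<Longrightarrow> smooth (h i)) \<Longrightarrow> smooth (\<lambda>P. \<Sum>i\<in>I. h i P)"
  by (induction I rule: infinite_finite_induct) (auto intro: smooth_intros)

lemma smooth_compose_linear: "bounded_linear L \<Longrightarrow> smooth h \<Longrightarrow> smooth (\<lambda>P. h (L P))"
  by (simp add: smooth_def differentiable_upto_compose_linear)

text \<open>
  A linear map is the bilinear map \<open>(c, x) \<mapsto> c L x\<close> with the constant 1 in its first argument, so the
  bilinear case covers it.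
\<close>
lemma smooth_linear:
  assumes "bounded_linear L" "smooth h" shows "smooth (\<lambda>P. L (h P))"
  using smooth_bilinear[of "\<lambda>(c::real) x. c *\<^sub>R L x" "\<lambda>_. 1" h] assms
    bounded_bilinear.comp[OF bounded_bilinear_scaleR bounded_linear_ident assms(1)]
  by (simp add: smooth_const)

lemma smooth_derivative [smooth_intros]: "smooth h \<Longrightarrow> smooth (\<lambda>P. frechet_derivative h (at P) v)"
  unfolding smooth_def by (metis differentiable_upto.simps(2))

lemma smooth_continuous: "smooth h \<Longrightarrow> continuous_on UNIV h"
  unfolding smooth_def by (metis differentiable_upto.simps(1))

lemma smooth_has_derivative:
  "smooth h \<Longrightarrow> (h has_derivative frechet_derivative h (at P)) (at P)"
  unfolding smooth_def by (metis differentiable_upto.simps(2) frechet_derivative_works)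

text \<open>
  The definition of smoothness differentiates in constant directions only; a variable direction is
  expanded in the standard basis.
\<close>
lemma smooth_derivative_along:
  assumes "smooth h" "smooth X"
  shows "smooth (\<lambda>P. frechet_derivative h (at P) (X P))"
proof -
  have "frechet_derivative h (at P) (X P) = (\<Sum>b\<in>Basis. (X P \<bullet> b) *\<^sub>R frechet_derivative h (at P) b)" for P
  proof -
    have l: "linear (frechet_derivative h (at P))"
      using smooth_has_derivative[OF assms(1)] has_derivative_linear by blast
    have "frechet_derivative h (at P) (X P) = frechet_derivative h (at P) (\<Sum>b\<in>Basis. (X P \<bullet> b) *\<^sub>R b)"
      by (simp add: euclidean_representation)
    also have "\<dots> = (\<Sum>b\<in>Basis. (X P \<bullet> b) *\<^sub>R frechet_derivative h (at P) b)"
      by (simp add: linear_sum[OF l] linear_scale[OF l])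
    finally show ?thesis .
  qed
  then show ?thesis
    using assms by (auto intro!: smooth_intros)
qed

text \<open>
  The left-hand side is symmetric in \<open>u\<close> and \<open>v\<close>, the right-hand side samples a mixed second derivative
  close to \<open>x\<close>.  This is what makes mixed derivatives commute.
\<close>
lemma second_difference_mean_value:
  fixes h :: "'a::euclidean_space \<Rightarrow> real"
  assumes "smooth h" "t > 0"
  shows "\<exists>\<xi> \<eta>. 0 < \<xi> \<and> \<xi> < t \<and> 0 < \<eta> \<and> \<eta> < t \<and>
    h (x + t *\<^sub>R u + t *\<^sub>R v) - h (x + t *\<^sub>R u) - h (x + t *\<^sub>R v) + h x =
    t * t * frechet_derivative (\<lambda>y. frechet_derivative h (at y) u) (at (x + \<xi> *\<^sub>R u + \<eta> *\<^sub>R v)) v"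
proof -
  have along: "((\<lambda>s. k (a + s *\<^sub>R w)) has_real_derivative frechet_derivative k (at (a + s *\<^sub>R w)) w) (at s)"
    if "smooth k" for k :: "'a \<Rightarrow> real" and a w s
  proof -
    have *: "((\<lambda>s. a + s *\<^sub>R w) has_derivative (\<lambda>s. s *\<^sub>R w)) (at s)"
      by (auto intro!: derivative_eq_intros)
    have l: "linear (frechet_derivative k (at (a + s *\<^sub>R w)))"
      using smooth_has_derivative[OF that] has_derivative_linear by blast
    show ?thesis
      using has_derivative_compose[OF * smooth_has_derivative[OF that]]
      by (simp add: has_field_derivative_def linear_scale[OF l] mult.commute[of _ "frechet_derivative _ _ _"])
  qed
  \<comment> \<open>The mean value theorem is applied in the direction \<open>u\<close> to the difference of \<open>h\<close> in the direction \<open>v\<close>,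
    and then in the direction \<open>v\<close> to the derivative along \<open>u\<close>.\<close>
  define g where "g s = h (x + t *\<^sub>R v + s *\<^sub>R u) - h (x + s *\<^sub>R u)" for s
  have "(g has_real_derivative frechet_derivative h (at (x + t *\<^sub>R v + s *\<^sub>R u)) u
     - frechet_derivative h (at (x + s *\<^sub>R u)) u) (at s)" for s
    unfolding g_def by (intro DERIV_diff along assms)
  from MVT2[OF \<open>t > 0\<close> this] obtain \<xi> where \<xi>: "0 < \<xi>" "\<xi> < t"
    "g t - g 0 = t * (frechet_derivative h (at (x + t *\<^sub>R v + \<xi> *\<^sub>R u)) u
     - frechet_derivative h (at (x + \<xi> *\<^sub>R u)) u)" by auto
  have "\<exists>\<eta>>0. \<eta> < t \<and> frechet_derivative h (at (x + \<xi> *\<^sub>R u + t *\<^sub>R v)) u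
     - frechet_derivative h (at (x + \<xi> *\<^sub>R u + 0 *\<^sub>R v)) u =
     (t - 0) * frechet_derivative (\<lambda>y. frechet_derivative h (at y) u) (at (x + \<xi> *\<^sub>R u + \<eta> *\<^sub>R v)) v"
    by (rule MVT2[OF \<open>t > 0\<close>, of "\<lambda>s. frechet_derivative h (at (x + \<xi> *\<^sub>R u + s *\<^sub>R v)) u"])
      (rule along[OF smooth_derivative[OF assms(1)]])
  then obtain \<eta> where \<eta>: "0 < \<eta>" "\<eta> < t" "frechet_derivative h (at (x + \<xi> *\<^sub>R u + t *\<^sub>R v)) u
     - frechet_derivative h (at (x + \<xi> *\<^sub>R u)) u =
     t * frechet_derivative (\<lambda>y. frechet_derivative h (at y) u) (at (x + \<xi> *\<^sub>R u + \<eta> *\<^sub>R v)) v"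
    by auto
  have "h (x + t *\<^sub>R u + t *\<^sub>R v) - h (x + t *\<^sub>R u) - h (x + t *\<^sub>R v) + h x = g t - g 0"
    by (simp add: g_def algebra_simps)
  also have "\<dots> = t * t * frechet_derivative (\<lambda>y. frechet_derivative h (at y) u) (at (x + \<xi> *\<^sub>R u + \<eta> *\<^sub>R v)) v"
    using \<xi>(3) \<eta>(3) by (simp add: add.commute add.left_commute mult.assoc)
  finally show ?thesis using \<xi>(1,2) \<eta>(1,2) by blast
qed

text \<open>
  Both orders of differentiation are limits, as the sampling points tend to \<open>x\<close>, of the same second
  difference divided by \<open>t\<^sup>2\<close>.
\<close>
lemma second_derivative_symmetric:
  fixes h :: "'a::euclidean_space \<Rightarrow> real"
  assumes "smooth h"
  shows "frechet_derivative (\<lambda>y. frechet_derivative h (at y) u) (at x) v =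
    frechet_derivative (\<lambda>y. frechet_derivative h (at y) v) (at x) u" (is "?A u v x = ?A v u x")
proof (rule ccontr)
  define e where "e = \<bar>?A u v x - ?A v u x\<bar> / 2"
  assume "?A u v x \<noteq> ?A v u x"
  then have "e > 0" by (simp add: e_def)
  have near: "\<exists>d>0. \<forall>y. dist y x < d \<longrightarrow> dist (?A u v y) (?A u v x) < e" for u v
  proof -
    have "continuous_on UNIV (?A u v)"
      by (intro smooth_continuous smooth_intros assms)
    then show ?thesis
      using \<open>e > 0\<close> unfolding continuous_on_iff by blast
  qed
  obtain d1 where d1: "d1 > 0" "\<And>y. dist y x < d1 \<Longrightarrow> dist (?A u v y) (?A u v x) < e"
    using near by blast
  obtain d2 where d2: "d2 > 0" "\<And>y. dist y x < d2 \<Longrightarrow> dist (?A v u y) (?A v u x) < e"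
    using near by blast
  \<comment> \<open>A side length for which the whole parallelogram lies in both neighbourhoods of \<open>x\<close>.\<close>
  define t where "t = min d1 d2 / (norm u + norm v + 1)"
  have "t > 0"
    unfolding t_def using d1(1) d2(1) by (intro divide_pos_pos) (auto simp: add_nonneg_pos)
  have small: "dist (x + a *\<^sub>R u + b *\<^sub>R v) x < min d1 d2" if "0 < a" "a < t" "0 < b" "b < t" for a b
  proof -
    have "dist (x + a *\<^sub>R u + b *\<^sub>R v) x \<le> a * norm u + b * norm v"
      using norm_triangle_ineq[of "a *\<^sub>R u" "b *\<^sub>R v"] that by (simp add: dist_norm)
    also have "\<dots> \<le> t * norm u + t * norm v"
      using that by (intro add_mono mult_right_mono) auto
    also have "\<dots> < t * (norm u + norm v + 1)"
      using \<open>t > 0\<close> by (simp add: algebra_simps)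
    also have "\<dots> = min d1 d2"
      unfolding t_def by (simp add: add_nonneg_eq_0_iff add_nonneg_pos less_imp_neq[symmetric])
    finally show ?thesis .
  qed
  obtain a b where ab: "0 < a" "a < t" "0 < b" "b < t"
    "h (x + t *\<^sub>R u + t *\<^sub>R v) - h (x + t *\<^sub>R u) - h (x + t *\<^sub>R v) + h x =
      t * t * ?A u v (x + a *\<^sub>R u + b *\<^sub>R v)"
    using second_difference_mean_value[OF assms \<open>t > 0\<close>] by blast
  obtain b' a' where ab': "0 < a'" "a' < t" "0 < b'" "b' < t"
    "h (x + t *\<^sub>R v + t *\<^sub>R u) - h (x + t *\<^sub>R v) - h (x + t *\<^sub>R u) + h x =
      t * t * ?A v u (x + b' *\<^sub>R v + a' *\<^sub>R u)"
    using second_difference_mean_value[OF assms \<open>t > 0\<close>] by blast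
  have "x + t *\<^sub>R v + t *\<^sub>R u = x + t *\<^sub>R u + t *\<^sub>R v"
    "x + b' *\<^sub>R v + a' *\<^sub>R u = x + a' *\<^sub>R u + b' *\<^sub>R v"
    by simp_all
  note ab'(5)[unfolded this]
  with ab(5) have "t * t * ?A u v (x + a *\<^sub>R u + b *\<^sub>R v) = t * t * ?A v u (x + a' *\<^sub>R u + b' *\<^sub>R v)"
    by linarith
  then have "?A u v (x + a *\<^sub>R u + b *\<^sub>R v) = ?A v u (x + a' *\<^sub>R u + b' *\<^sub>R v)"
    using \<open>t > 0\<close> by simp
  moreover have "dist (?A u v (x + a *\<^sub>R u + b *\<^sub>R v)) (?A u v x) < e"
    using small[OF ab(1-4)] by (intro d1(2)) simp
  moreover have "dist (?A v u (x + a' *\<^sub>R u + b' *\<^sub>R v)) (?A v u x) < e"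
    using small[OF ab'(1-4)] by (intro d2(2)) simp
  ultimately show False
    using dist_triangle_half_r[of _ "?A u v x" "2 * e" "?A v u x"]
    by (simp add: e_def dist_real_def)
qed

section \<open>Jordan forms of operators with values in the vertical distribution\<close>

text \<open>
  A basis of \<open>S\<close> and its image under \<open>h\<close> extend to bases of the whole space with equally many new
  vectors.
\<close>
lemma linear_inj_on_extends_to_bij:
  fixes h :: "'a::euclidean_space \<Rightarrow> 'a"
  assumes h: "linear h" "inj_on h S" and S: "subspace S"
  shows "\<exists>\<phi>. linear \<phi> \<and> bij \<phi> \<and> (\<forall>x\<in>S. \<phi> x = h x)"
proof -
  obtain B where B: "B \<subseteq> S" "independent B" "S \<subseteq> span B"
    using maximal_independent_subset by blast
  have "span B = S"
    using B S by (simp add: span_minimal subset_antisym)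
  then have "independent (h ` B)"
    using linear_independent_injective_image[OF h(1) B(2)] h(2) by simp
  then obtain \<phi> where \<phi>: "linear \<phi>" "inj \<phi>" "\<forall>x\<in>B. \<phi> x = h x"
    using eucl.linear_independent_extend_inj[OF B(2) _ inj_on_subset[OF h(2) B(1)]] by blast
  have "\<forall>x\<in>S. \<phi> x = h x"
  proof
    fix x assume "x \<in> S"
    with \<open>span B = S\<close> have "x \<in> span B" by simp
    then show "\<phi> x = h x"
      using linear_eq_on[OF \<phi>(1) h(1), of x B] \<phi>(3) by simp
  qed
  then show ?thesis
    using \<phi>(1,2) linear_injective_imp_surjective[OF \<phi>(1,2)] by (auto simp: bij_def)
qed

text \<open>
  Equal kernel dimension makes \<open>T\<close> and \<open>T'\<close> equal up to independent changes of basis in source and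
  target: a bijection \<open>\<alpha>\<close> that matches the kernels induces a map between the ranges, and this map
  extends to the bijection \<open>\<beta>\<close>.
\<close>
lemma linear_equivalence_of_kernel_dim:
  fixes T T' :: "'a::euclidean_space \<Rightarrow> 'a"
  assumes T: "linear T" and T': "linear T'" and d: "dim {x. T x = 0} = dim {x. T' x = 0}"
  shows "\<exists>\<alpha> \<beta>. linear \<alpha> \<and> bij \<alpha> \<and> linear \<beta> \<and> bij \<beta> \<and> \<beta> \<circ> T = T' \<circ> \<alpha>"
proof -
  let ?K = "{x. T x = 0}" and ?K' = "{x. T' x = 0}"
  have K: "subspace ?K" "subspace ?K'"
    using T T' by (simp_all add: linear_subspace_kernel)
  obtain m where m: "linear m" "m ` ?K = ?K'" "inj_on m ?K"
    using subspace_isomorphism[OF K d] by blast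
  then obtain \<alpha> where \<alpha>: "linear \<alpha>" "bij \<alpha>" "\<forall>x\<in>?K. \<alpha> x = m x"
    using linear_inj_on_extends_to_bij[OF m(1,3) K(1)] by blast
  have \<alpha>K: "T' (\<alpha> x) = 0 \<longleftrightarrow> T x = 0" for x
  proof -
    have "\<alpha> ` ?K = ?K'"
      using image_cong[of ?K ?K \<alpha> m] \<alpha>(3) m(2) by auto
    moreover have "\<alpha> x \<in> \<alpha> ` ?K \<longleftrightarrow> x \<in> ?K"
      using \<alpha>(2) by (simp add: bij_is_inj inj_image_mem_iff)
    ultimately show ?thesis by simp
  qed
  obtain s where s: "linear s" "\<forall>y\<in>range T. T (s y) = y"
    using linear_exists_right_inverse_on[OF T subspace_UNIV] by blast
  \<comment> \<open>\<open>h\<close> is the map between the ranges.  The choice of the preimage \<open>s\<close> does not matter, because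
    \<open>\<alpha>\<close> sends the kernel of \<open>T\<close> into the kernel of \<open>T'\<close>.\<close>
  define h where "h = T' \<circ> \<alpha> \<circ> s"
  have h: "linear h"
    unfolding h_def by (intro linear_compose s(1) \<alpha>(1) T')
  have hT: "h (T x) = T' (\<alpha> x)" for x
  proof -
    have "T (s (T x) - x) = 0"
      using s(2) by (simp add: linear_diff[OF T])
    then have "T' (\<alpha> (s (T x) - x)) = 0"
      by (simp add: \<alpha>K)
    then show ?thesis
      by (simp add: h_def linear_diff[OF T'] linear_diff[OF \<alpha>(1)])
  qed
  have R: "subspace (range T)"
    using T linear_subspace_image subspace_UNIV by blast
  have "inj_on h (range T)"
    unfolding linear_injective_on_subspace_0[OF h R] using hT \<alpha>K by auto
  then obtain \<beta> where \<beta>: "linear \<beta>" "bij \<beta>" "\<forall>x\<in>range T. \<beta> x = h x"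
    using linear_inj_on_extends_to_bij[OF h _ R] by blast
  have "\<beta> \<circ> T = T' \<circ> \<alpha>"
    using \<beta>(3) hT by auto
  then show ?thesis
    using \<alpha> \<beta> by blast
qed

text \<open>
  The vectors \<open>(0, b)\<close> span the vertical distribution of the fields \<open>\<partial>/\<partial>y\<^sub>i\<close>; operators of this form
  annihilate it and take their values in it.
\<close>
definition vertical :: "('a \<Rightarrow> 'a::zero) \<Rightarrow> 'a \<times> 'a \<Rightarrow> 'a \<times> 'a" where
  "vertical T = (\<lambda>Y. (0, T (fst Y)))"

lemma same_jordan_form_kernel_dim:
  assumes "same_jordan_form A B"
  shows "dim {x. A x = 0} = dim {x. B x = 0}"
proof -
  from assms obtain \<phi> where \<phi>: "linear \<phi>" "bij \<phi>" "\<phi> \<circ> A = B \<circ> \<phi>"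
    unfolding same_jordan_form_def by blast
  have "B (\<phi> x) = 0 \<longleftrightarrow> A x = 0" for x
  proof -
    have "B (\<phi> x) = \<phi> (A x)" using \<phi>(3) by (metis comp_apply)
    then show ?thesis
      using \<phi>(1,2) by (metis bij_is_inj injD linear_0)
  qed
  then have "{x. B x = 0} = \<phi> ` {x. A x = 0}"
    using bij_is_surj[OF \<phi>(2)] by (auto simp: image_iff) (metis surjD)
  then show ?thesis
    using dim_image_eq[OF \<phi>(1)] \<phi>(2) by (metis bij_is_inj inj_on_subset subset_UNIV)
qed

text \<open>
  Equal kernel dimensions suffice because the two factors of the product space can be transformed
  independently of each other, the first as the source and the second as the target of \<open>T\<close>.  Conversely,
  conjugation preserves the dimension of the kernel, which is that of \<open>T\<close> times the whole second factor.
\<close>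
lemma same_jordan_form_vertical:
  fixes T T' :: "'a::euclidean_space \<Rightarrow> 'a"
  assumes T: "linear T" and T': "linear T'"
  shows "same_jordan_form (vertical T) (vertical T') \<longleftrightarrow> dim {x. T x = 0} = dim {x. T' x = 0}"
proof
  have ker: "dim {x. vertical S x = 0} = dim {x. S x = 0} + DIM('a)" if "linear S" for S :: "'a \<Rightarrow> 'a"
  proof -
    have "{x. vertical S x = 0} = {x. S x = 0} \<times> (UNIV :: 'a set)"
      by (auto simp: vertical_def zero_prod_def)
    then show ?thesis
      using dim_Times[OF linear_subspace_kernel[OF that] subspace_UNIV[where 'a='a]] by simp
  qed
  show "dim {x. T x = 0} = dim {x. T' x = 0}" if "same_jordan_form (vertical T) (vertical T')"
    using same_jordan_form_kernel_dim[OF that] ker[OF T] ker[OF T'] by linarith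
  assume "dim {x. T x = 0} = dim {x. T' x = 0}"
  then obtain \<alpha> \<beta> where ab: "linear \<alpha>" "bij \<alpha>" "linear \<beta>" "bij \<beta>" "\<beta> \<circ> T = T' \<circ> \<alpha>"
    using linear_equivalence_of_kernel_dim[OF T T'] by blast
  have "linear (map_prod \<alpha> \<beta>)"
    using ab(1,3) by (auto simp: linear_iff)
  moreover have "bij (map_prod \<alpha> \<beta>)"
    using bij_betw_map_prod[OF ab(2,4)] by simp
  moreover have "map_prod \<alpha> \<beta> \<circ> vertical T = vertical T' \<circ> map_prod \<alpha> \<beta>"
    using ab(5) linear_0[OF ab(1)] by (auto simp: vertical_def fun_eq_iff)
  ultimately show "same_jordan_form (vertical T) (vertical T')"
    unfolding same_jordan_form_def by (intro exI[of _ "map_prod \<alpha> \<beta>"] conjI)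
qed

text \<open>
  The square of the operator is zero, so an eigenvalue \<open>z\<close> satisfies \<open>z\<^sup>2 = 0\<close>; the vertical
  vectors are eigenvectors for 0.
\<close>
lemma complex_eigenvalues_vertical:
  fixes T :: "'a::euclidean_space \<Rightarrow> 'a"
  assumes T: "linear T"
  shows "complex_eigenvalues (vertical T) = {0}"
proof (intro subset_antisym subsetI)
  fix z assume "z \<in> complex_eigenvalues (vertical T)"
  then obtain u v where uv: "u \<noteq> 0 \<or> v \<noteq> 0"
    "vertical T u = Re z *\<^sub>R u - Im z *\<^sub>R v" "vertical T v = Im z *\<^sub>R u + Re z *\<^sub>R v"
    unfolding complex_eigenvalues_def by blast
  \<comment> \<open>This is \<open>z (a + \<i> b) = 0\<close> with \<open>z \<noteq> 0\<close>, written in real and imaginary parts.\<close>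
  have null: "a = 0 \<and> b = 0" if "Re z *\<^sub>R a - Im z *\<^sub>R b = 0" "Im z *\<^sub>R a + Re z *\<^sub>R b = 0" "z \<noteq> 0"
    for a b :: 'a
  proof -
    have r: "(Re z)\<^sup>2 + (Im z)\<^sup>2 \<noteq> 0"
      using that(3) by (metis complex_eq_0)
    have "((Re z)\<^sup>2 + (Im z)\<^sup>2) *\<^sub>R a
        = Re z *\<^sub>R (Re z *\<^sub>R a - Im z *\<^sub>R b) + Im z *\<^sub>R (Im z *\<^sub>R a + Re z *\<^sub>R b)"
      by (simp add: algebra_simps power2_eq_square)
    moreover have "((Re z)\<^sup>2 + (Im z)\<^sup>2) *\<^sub>R b
        = Re z *\<^sub>R (Im z *\<^sub>R a + Re z *\<^sub>R b) - Im z *\<^sub>R (Re z *\<^sub>R a - Im z *\<^sub>R b)"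
      by (simp add: algebra_simps power2_eq_square)
    ultimately show ?thesis
      unfolding that(1,2) using r by auto
  qed
  have "z = 0"
  proof (rule ccontr)
    assume z: "z \<noteq> 0"
    have "fst u = 0 \<and> fst v = 0"
      using uv(2,3)[THEN arg_cong[of _ _ fst]] by (intro null z) (simp_all add: vertical_def)
    moreover from this have "snd u = 0 \<and> snd v = 0"
      using uv(2,3)[THEN arg_cong[of _ _ snd]] linear_0[OF T] by (intro null z) (simp_all add: vertical_def)
    ultimately show False
      using uv(1) by (simp add: prod_eq_iff)
  qed
  then show "z \<in> {0}" by simp
next
  fix z :: complex assume "z \<in> {0}"
  obtain b :: 'a where "b \<noteq> 0"
    using nonzero_Basis SOME_Basis by blast
  then have "(0::'a, b) \<noteq> 0" "vertical T (0::'a, b) = 0"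
    using linear_0[OF T] by (auto simp: vertical_def zero_prod_def)
  then show "z \<in> complex_eigenvalues (vertical T)"
    using \<open>z \<in> {0}\<close> linear_0[OF T] unfolding complex_eigenvalues_def mem_Collect_eq
    by (intro exI[of _ "(0::'a, b)"] exI[of _ 0]) (simp add: vertical_def zero_prod_def)
qed

section \<open>Kernels of the operators built from a symmetric map\<close>

lemma dim_orthogonal_vectors:
  fixes S :: "'a::euclidean_space set"
  shows "dim {w. \<forall>a\<in>S. a \<bullet> w = 0} + dim S = DIM('a)"
proof -
  have "{w. \<forall>a\<in>S. a \<bullet> w = 0} = {w \<in> UNIV. \<forall>a\<in>span S. orthogonal a w}"
  proof (intro subset_antisym subsetI)
    fix w assume "w \<in> {w. \<forall>a\<in>S. a \<bullet> w = 0}"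
    then have "S \<subseteq> {a. a \<bullet> w = 0}" by auto
    moreover have "subspace {a. a \<bullet> w = 0}"
      by (simp add: subspace_hyperplane2)
    ultimately have "span S \<subseteq> {a. a \<bullet> w = 0}"
      by (rule span_minimal)
    then show "w \<in> {w \<in> UNIV. \<forall>a\<in>span S. orthogonal a w}"
      by (auto simp: orthogonal_def)
  qed (auto simp: orthogonal_def span_base)
  then show ?thesis
    using dim_subspace_orthogonal_to_vectors[OF subspace_span subspace_UNIV subset_UNIV, of S] by simp
qed

definition independent_pair :: "'a::real_vector \<Rightarrow> 'a \<Rightarrow> bool" where
  "independent_pair x y \<longleftrightarrow> (\<forall>a b. a *\<^sub>R x + b *\<^sub>R y = 0 \<longrightarrow> a = 0 \<and> b = 0)"

lemma dim_independent_pair: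
  fixes x y :: "'a::euclidean_space"
  assumes "independent_pair x y"
  shows "dim {x, y} = 2"
proof -
  have "x \<noteq> y"
    using assms[unfolded independent_pair_def, rule_format, of 1 "-1"] by auto
  moreover have "independent {x, y}"
  proof (rule independent_insertI)
    show "x \<notin> span {y}"
    proof
      assume "x \<in> span {y}"
      then obtain k where "x = k *\<^sub>R y" by (auto simp: span_singleton)
      then show False
        using assms[unfolded independent_pair_def, rule_format, of 1 "-k"] by simp
    qed
    show "independent {y}"
      using assms[unfolded independent_pair_def, rule_format, of 0 1] by auto
  qed
  ultimately show ?thesis
    by (simp add: dim_eq_card_independent)
qed

text \<open>
  Applying the inverse of \<open>H\<close>, a kernel vector satisfies \<open>(H x \<bullet> x) y = (H y \<bullet> x) x\<close>.  If \<open>H x \<bullet> x \<noteq> 0\<close> this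
  says that \<open>y\<close> is a multiple of \<open>x\<close>; otherwise it says that \<open>H y \<bullet> x = y \<bullet> H x\<close> vanishes.
\<close>
lemma dim_kernel_jacobi:
  fixes H :: "'a::euclidean_space \<Rightarrow> 'a"
  assumes lin: "linear H"
    and sym: "\<And>u v. H u \<bullet> v = H v \<bullet> u"
    and inj: "\<And>u. H u = 0 \<longleftrightarrow> u = 0"
    and x: "x \<noteq> 0"
  shows "dim {y. (H x \<bullet> x) *\<^sub>R H y - (H y \<bullet> x) *\<^sub>R H x = 0} =
    (if H x \<bullet> x = 0 then DIM('a) - 1 else 1)"
proof (cases "H x \<bullet> x = 0")
  case True
  have "(H x \<bullet> x) *\<^sub>R H y - (H y \<bullet> x) *\<^sub>R H x = 0 \<longleftrightarrow> (\<forall>a\<in>{H x}. a \<bullet> y = 0)" for y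
    unfolding sym[of y x] True using x by (simp add: inj)
  moreover have "dim {H x} = 1"
    using x inj[of x] by (simp add: dim_eq_card_independent)
  ultimately show ?thesis
    using True dim_orthogonal_vectors[of "{H x}"] by simp
next
  case False
  have "{y. (H x \<bullet> x) *\<^sub>R H y - (H y \<bullet> x) *\<^sub>R H x = 0} = span {x}"
  proof (intro subset_antisym subsetI)
    fix y assume "y \<in> {y. (H x \<bullet> x) *\<^sub>R H y - (H y \<bullet> x) *\<^sub>R H x = 0}"
    then have "H ((H x \<bullet> x) *\<^sub>R y - (H y \<bullet> x) *\<^sub>R x) = 0"
      by (simp add: linear_diff[OF lin] linear_scale[OF lin])
    then have "(H x \<bullet> x) *\<^sub>R y = (H y \<bullet> x) *\<^sub>R x"
      by (simp add: inj)
    then have "inverse (H x \<bullet> x) *\<^sub>R (H x \<bullet> x) *\<^sub>R y =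
        inverse (H x \<bullet> x) *\<^sub>R (H y \<bullet> x) *\<^sub>R x"
      by (rule arg_cong)
    then have "y = (inverse (H x \<bullet> x) * (H y \<bullet> x)) *\<^sub>R x"
      using False by simp
    then show "y \<in> span {x}"
      by (auto simp: span_singleton)
  qed (auto simp: span_singleton linear_scale[OF lin])
  moreover have "dim {x} = 1"
    using x by (simp add: dim_eq_card_independent)
  ultimately show ?thesis
    using False by simp
qed

text \<open>
  \<open>H x\<^sub>1\<close> and \<open>H x\<^sub>2\<close> are independent as well, so both coefficients vanish on the kernel, which is
  therefore the orthogonal complement of a plane.
\<close>
lemma dim_kernel_skew:
  fixes H :: "'a::euclidean_space \<Rightarrow> 'a"
  assumes lin: "linear H"
    and inj: "\<And>u. H u = 0 \<longleftrightarrow> u = 0"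
    and x: "independent_pair x1 x2"
  shows "dim {w. (H x2 \<bullet> w) *\<^sub>R H x1 - (H x1 \<bullet> w) *\<^sub>R H x2 = 0} = DIM('a) - 2"
proof -
  have ind: "independent_pair (H x1) (H x2)"
    unfolding independent_pair_def
  proof (intro allI impI)
    fix a b assume "a *\<^sub>R H x1 + b *\<^sub>R H x2 = 0"
    then have "H (a *\<^sub>R x1 + b *\<^sub>R x2) = 0"
      by (simp add: linear_add[OF lin] linear_scale[OF lin])
    then show "a = 0 \<and> b = 0"
      using x by (simp add: inj independent_pair_def)
  qed
  have "(H x2 \<bullet> w) *\<^sub>R H x1 - (H x1 \<bullet> w) *\<^sub>R H x2 = 0 \<longleftrightarrow> (\<forall>a\<in>{H x1, H x2}. a \<bullet> w = 0)" for w
    using ind[unfolded independent_pair_def, rule_format, of "H x2 \<bullet> w" "- (H x1 \<bullet> w)"] by auto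
  then show ?thesis
    using dim_orthogonal_vectors[of "{H x1, H x2}"] dim_independent_pair[OF ind] by simp
qed

text \<open>
  On the line \<open>u + s v\<close> the form is a quadratic polynomial in \<open>s\<close> whose constant and leading coefficients
  have opposite signs, hence it has a real root.  No point of the line is zero, since \<open>u\<close> is not a
  multiple of \<open>v\<close>.
\<close>
lemma indefinite_null_vector:
  fixes H :: "'a::euclidean_space \<Rightarrow> 'a"
  assumes lin: "linear H"
    and sym: "\<And>u v. H u \<bullet> v = H v \<bullet> u"
    and uv: "H u \<bullet> u > 0" "H v \<bullet> v < 0"
  shows "\<exists>x. x \<noteq> 0 \<and> H x \<bullet> x = 0"
proof -
  define a b c where "a = H u \<bullet> u" and "b = H u \<bullet> v" and "c = H v \<bullet> v"
  define t where "t = (- b - sqrt (b\<^sup>2 - a * c)) / c"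
  have q: "H (u + s *\<^sub>R v) \<bullet> (u + s *\<^sub>R v) = a + 2 * b * s + c * s\<^sup>2" for s
    by (simp add: a_def b_def c_def linear_add[OF lin] linear_scale[OF lin] inner_add_left
        inner_add_right sym[of v u] power2_eq_square algebra_simps)
  have c: "a > 0" "c < 0" using uv by (simp_all add: a_def c_def)
  then have "a * c \<le> 0" by (simp add: mult_nonneg_nonpos)
  then have disc: "b\<^sup>2 - a * c \<ge> 0"
    using zero_le_power2[of b] by linarith
  have "c * t + b = - sqrt (b\<^sup>2 - a * c)"
    using c by (simp add: t_def)
  then have "(c * t + b)\<^sup>2 = b\<^sup>2 - a * c"
    using disc by simp
  then have "c * (a + 2 * b * t + c * t\<^sup>2) = 0"
    by (simp add: power2_eq_square algebra_simps)
  then have "H (u + t *\<^sub>R v) \<bullet> (u + t *\<^sub>R v) = 0"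
    using c by (simp add: q)
  moreover have "u + t *\<^sub>R v \<noteq> 0"
  proof
    assume "u + t *\<^sub>R v = 0"
    then have "u = (- t) *\<^sub>R v" by (simp add: eq_neg_iff_add_eq_0)
    then have "a = t\<^sup>2 * c"
      by (simp add: a_def c_def linear_scale[OF lin] linear_neg[OF lin] power2_eq_square)
    moreover have "t\<^sup>2 * c \<le> 0"
      using c by (intro mult_nonneg_nonpos) simp_all
    ultimately show False
      using c by linarith
  qed
  ultimately show ?thesis by blast
qed

section \<open>The Levi-Civita connection and the curvature\<close>

text \<open>
  The trilinear form \<open>c(X, Y, Z) = g(D X Y - D' X Y, Z)\<close> is symmetric in \<open>X, Y\<close>, since both torsions
  vanish, and skew in \<open>Y, Z\<close>, since both connections are metric.  Such a form is zero, so the difference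
  is orthogonal to every vector.
\<close>
lemma levi_civita_unique:
  assumes sym: "\<And>P u v. g P u v = g P v u"
    and diff: "\<And>P u u' v. g P (u - u') v = g P u v - g P u' v"
    and nondeg: "\<And>P u. (\<And>v. g P u v = 0) \<Longrightarrow> u = 0"
    and D: "affine_connection D" "torsion_free D" "metric_compatible g D"
    and D': "affine_connection D'" "torsion_free D'" "metric_compatible g D'"
    and XY: "smooth X" "smooth Y"
  shows "D X Y = D' X Y"
proof
  fix P
  define c where "c X Y Z = g P (D X Y P - D' X Y P) (Z P)" for X Y Z
  have c12: "c X Y Z = c Y X Z" if "smooth X" "smooth Y" for X Y Z
  proof -
    have "D X Y P - D Y X P = D' X Y P - D' Y X P"
      using D(2) D'(2) that by (simp add: torsion_free_def)
    then have "D X Y P - D' X Y P = D Y X P - D' Y X P"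
      by (simp add: algebra_simps)
    then show ?thesis by (simp add: c_def)
  qed
  have c23: "c X Y Z = - c X Z Y" if "smooth X" "smooth Y" "smooth Z" for X Y Z
  proof -
    have "g P (D X Y P) (Z P) + g P (Y P) (D X Z P) = g P (D' X Y P) (Z P) + g P (Y P) (D' X Z P)"
      using D(3) D'(3) that unfolding metric_compatible_def by metis
    then show ?thesis
      unfolding c_def diff sym[of P "Y P"] by linarith
  qed
  have "g P (D X Y P - D' X Y P) v = 0" for v
  proof -
    have Z: "smooth (\<lambda>_::'a. v)" by (rule smooth_const)
    have "c X Y (\<lambda>_. v) = c Y X (\<lambda>_. v)"
      by (rule c12[OF XY])
    also have "\<dots> = - c Y (\<lambda>_. v) X"
      by (rule c23[OF XY(2,1) Z])
    also have "\<dots> = - c (\<lambda>_. v) Y X"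
      using c12[OF XY(2) Z] by simp
    also have "\<dots> = c (\<lambda>_. v) X Y"
      using c23[OF Z XY(2,1)] by simp
    also have "\<dots> = c X (\<lambda>_. v) Y"
      by (rule c12[OF Z XY(1)])
    also have "\<dots> = - c X Y (\<lambda>_. v)"
      by (rule c23[OF XY(1) Z XY(2)])
    finally have "c X Y (\<lambda>_. v) = 0" by simp
    then show ?thesis by (simp add: c_def)
  qed
  then show "D X Y P = D' X Y P"
    using nondeg[of P "D X Y P - D' X Y P"] by simp
qed

definition grad :: "(real^'p::finite \<Rightarrow> real) \<Rightarrow> real^'p \<Rightarrow> real^'p" where
  "grad f x = (\<chi> i. partial i f x)"

definition hess :: "(real^'p::finite \<Rightarrow> real) \<Rightarrow> real^'p \<Rightarrow> real^'p \<Rightarrow> real^'p" where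
  "hess f x = frechet_derivative (grad f) (at x)"

lemma grad_inner:
  assumes "smooth f"
  shows "grad f x \<bullet> v = frechet_derivative f (at x) v"
proof -
  have l: "linear (frechet_derivative f (at x))"
    using smooth_has_derivative[OF assms] has_derivative_linear by blast
  have "frechet_derivative f (at x) v = frechet_derivative f (at x) (\<Sum>i\<in>UNIV. v $ i *\<^sub>R axis i 1)"
    by (simp only: basis_expansion flip: scalar_mult_eq_scaleR)
  also have "\<dots> = (\<Sum>i\<in>UNIV. v $ i *\<^sub>R partial i f x)"
    by (simp add: linear_sum[OF l] linear_scale[OF l] partial_def)
  finally show ?thesis
    by (simp add: grad_def inner_vec_def mult.commute)
qed

lemma smooth_grad [smooth_intros]:
  assumes "smooth f"
  shows "smooth (grad f)"
proof -
  have "grad f = (\<lambda>x. \<Sum>i\<in>UNIV. partial i f x *\<^sub>R axis i 1)"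
  proof
    fix x
    have "grad f x = (\<Sum>i\<in>UNIV. grad f x $ i *s axis i 1)"
      by (simp only: basis_expansion)
    then show "grad f x = (\<Sum>i\<in>UNIV. partial i f x *\<^sub>R axis i 1)"
      by (simp add: grad_def scalar_mult_eq_scaleR)
  qed
  moreover have "smooth (partial i f)" for i
    unfolding partial_def by (intro smooth_intros assms)
  ultimately show ?thesis
    by (auto intro!: smooth_intros)
qed

lemma hess_works:
  "smooth f \<Longrightarrow> (grad f has_derivative hess f x) (at x)"
  unfolding hess_def by (intro smooth_has_derivative smooth_grad)

lemma linear_hess: "smooth f \<Longrightarrow> linear (hess f x)"
  using hess_works has_derivative_linear by blast

lemma grad_inner_has_derivative:
  "smooth f \<Longrightarrow> ((\<lambda>x. grad f x \<bullet> w) has_derivative (\<lambda>u. hess f x u \<bullet> w)) (at x)"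
  using has_derivative_inner_left[OF hess_works] .

lemma hess_symmetric:
  assumes "smooth f"
  shows "hess f x u \<bullet> v = hess f x v \<bullet> u"
proof -
  have "hess f x u \<bullet> v = frechet_derivative (\<lambda>y. frechet_derivative f (at y) v) (at x) u" for u v
    using frechet_derivative_eqI[OF grad_inner_has_derivative[OF assms]]
    by (simp add: grad_inner[OF assms] fun_eq_iff)
  then show ?thesis
    using second_derivative_symmetric[OF assms] by metis
qed

text \<open>
  The third derivatives of \<open>f\<close> are symmetric, which is the reason why they do not appear in the curvature.
\<close>
lemma hess_derivative_symmetric:
  assumes "smooth f"
  shows "frechet_derivative (\<lambda>y. hess f y v) (at x) u \<bullet> w = frechet_derivative (\<lambda>y. hess f y u) (at x) v \<bullet> w"
proof -
  have s: "smooth (\<lambda>y. grad f y \<bullet> w)"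
    by (intro smooth_intros assms)
  have "frechet_derivative (\<lambda>y. hess f y v) (at x) u \<bullet> w =
      frechet_derivative (\<lambda>y. frechet_derivative (\<lambda>y. grad f y \<bullet> w) (at y) v) (at x) u" for u v
  proof -
    have "smooth (\<lambda>y. hess f y v)"
      unfolding hess_def by (intro smooth_intros assms)
    note d = has_derivative_inner_left[OF smooth_has_derivative[OF this]]
    show ?thesis
      by (simp add: frechet_derivative_eqI[OF grad_inner_has_derivative[OF assms]]
          frechet_derivative_eqI[OF d])
  qed
  then show ?thesis
    using second_derivative_symmetric[OF s] by simp
qed

lemma metric_f_eq:
  "metric_f f P u v = fst u \<bullet> snd v + snd u \<bullet> fst v + (grad f (fst P) \<bullet> fst u) * (grad f (fst P) \<bullet> fst v)"
  by (simp add: metric_f_def grad_def inner_vec_def sum.distrib sum_product ac_simps)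

lemma form_L_eq:
  assumes "smooth f"
  shows "form_L f P u v = hess f (fst P) (fst u) \<bullet> fst v"
proof -
  have p: "partial i (partial j f) x = hess f x (axis i 1) $ j" for i j x
  proof -
    have "((\<lambda>x. grad f x $ j) has_derivative (\<lambda>u. hess f x u $ j)) (at x)"
      by (rule bounded_linear.has_derivative[OF bounded_linear_vec_nth hess_works[OF assms]])
    from frechet_derivative_eqI[OF this] show ?thesis
      by (simp add: partial_def[of i] grad_def)
  qed
  note l = linear_hess[OF assms]
  have "hess f (fst P) (fst u) = hess f (fst P) (\<Sum>i\<in>UNIV. fst u $ i *\<^sub>R axis i 1)"
    by (simp only: basis_expansion flip: scalar_mult_eq_scaleR)
  also have "\<dots> = (\<Sum>i\<in>UNIV. fst u $ i *\<^sub>R hess f (fst P) (axis i 1))"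
    by (simp add: linear_sum[OF l] linear_scale[OF l])
  finally have "hess f (fst P) (fst u) \<bullet> fst v =
      (\<Sum>i\<in>UNIV. fst u $ i * (hess f (fst P) (axis i 1) \<bullet> fst v))"
    by (simp add: inner_sum_left)
  then show ?thesis
    by (simp add: form_L_def p inner_vec_def sum_distrib_left ac_simps)
qed

lemma distribution_X_eq: "distribution_X = UNIV \<times> {0::real^'p::finite}"
proof -
  have "distribution_X = (\<lambda>x. (x, 0)) ` span (range (\<lambda>i. axis i (1::real)))"
    unfolding distribution_X_def
    by (subst linear_span_image[symmetric]) (auto simp: linear_iff image_image)
  also have "span (range (\<lambda>i. axis i (1::real))) = (UNIV :: (real^'p) set)"
    using span_Basis[where 'a = "real^'p"] by (simp add: Basis_vec_def UNION_singleton_eq_range)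
  finally show ?thesis by auto
qed

lemma hess_nondegenerate:
  assumes "smooth f" "\<And>P. nondegenerate_on (form_L f P) distribution_X"
  shows "hess f x u = 0 \<longleftrightarrow> u = 0"
proof
  assume "hess f x u = 0"
  then have "form_L f (x, 0) (u, 0) v = 0" for v
    by (simp add: form_L_eq[OF assms(1)])
  then show "u = 0"
    using assms(2)[of "(x, 0)"] by (auto simp: nondegenerate_on_def distribution_X_eq zero_prod_def)
qed (simp add: linear_0[OF linear_hess[OF assms(1)]])

text \<open>
  The flat derivative corrected by the Christoffel symbols.  For \<open>g\<^sub>i\<^sub>j = f\<^sub>i f\<^sub>j\<close> the Koszul expression
  \<open>(\<partial>\<^sub>i g\<^sub>j\<^sub>k + \<partial>\<^sub>j g\<^sub>i\<^sub>k - \<partial>\<^sub>k g\<^sub>i\<^sub>j) / 2\<close> collapses to \<open>f\<^sub>i\<^sub>j f\<^sub>k\<close>, and the metric turns the covector with these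
  components into a vertical vector.
\<close>
definition connection_f ::
  "(real^'p::finite \<Rightarrow> real) \<Rightarrow> ((real^'p) \<times> (real^'p) \<Rightarrow> (real^'p) \<times> (real^'p)) \<Rightarrow>
    ((real^'p) \<times> (real^'p) \<Rightarrow> (real^'p) \<times> (real^'p)) \<Rightarrow> (real^'p) \<times> (real^'p) \<Rightarrow> (real^'p) \<times> (real^'p)" where
  "connection_f f X Y P = frechet_derivative Y (at P) (X P) +
     (0, (hess f (fst P) (fst (X P)) \<bullet> fst (Y P)) *\<^sub>R grad f (fst P))"

lemma smooth_connection_f:
  assumes "smooth f" and X: "smooth X" and Y: "smooth Y"
  shows "smooth (connection_f f X Y)"
proof -
  \<comment> \<open>The Hessian term is a derivative along a vector field: that of the gradient, pulled back to \<open>M\<close>,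
    along the \<open>x\<close>-part of \<open>X\<close>.\<close>
  have "smooth (\<lambda>P. frechet_derivative (\<lambda>P. grad f (fst P)) (at P) (fst (X P), 0))"
    by (intro smooth_derivative_along smooth_compose_linear[OF bounded_linear_fst] smooth_grad assms(1)
        smooth_linear[of "\<lambda>P. (fst P, 0)"] X bounded_linear_intros)
  moreover have "frechet_derivative (\<lambda>P. grad f (fst P)) (at P) (fst (X P), 0) = hess f (fst P) (fst (X P))" for P
    by (subst frechet_derivative_eqI[OF has_derivative_compose[OF
        bounded_linear_imp_has_derivative[OF bounded_linear_fst] hess_works[OF assms(1)]]]) simp
  ultimately have "smooth (\<lambda>P. hess f (fst P) (fst (X P)))" by simp
  then have "smooth (\<lambda>P. (0::real^'p, (hess f (fst P) (fst (X P)) \<bullet> fst (Y P)) *\<^sub>R grad f (fst P)))"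
    by (intro smooth_linear[of "\<lambda>x. (0, x)"] smooth_intros smooth_compose_linear[OF bounded_linear_fst]
        smooth_linear[OF bounded_linear_fst] assms(1) Y bounded_linear_intros)
  then show ?thesis
    unfolding connection_f_def[abs_def]
    by (intro smooth_add smooth_derivative_along X Y)
qed

lemma affine_connection_f:
  fixes f :: "real^'p::finite \<Rightarrow> real"
  assumes "smooth f" 
  shows "affine_connection (connection_f f)"
  unfolding affine_connection_def
proof (intro conjI allI impI)
  note lh = linear_hess[OF assms]
  have l: "linear (frechet_derivative Y (at P))" if "smooth Y" for Y :: "(real^'p) \<times> (real^'p) \<Rightarrow> (real^'p) \<times> (real^'p)" and P
    using smooth_has_derivative[OF that] has_derivative_linear by blast
  fix X X' Y Y' :: "(real^'p) \<times> (real^'p) \<Rightarrow> (real^'p) \<times> (real^'p)" and h :: "(real^'p) \<times> (real^'p) \<Rightarrow> real"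
  show "smooth (connection_f f X Y)" if "smooth X \<and> smooth Y"
    using that by (simp add: smooth_connection_f[OF assms])
  show "connection_f f (\<lambda>P. X P + X' P) Y = (\<lambda>P. connection_f f X Y P + connection_f f X' Y P)"
    if "smooth X \<and> smooth X' \<and> smooth Y"
    using that
    by (auto simp: connection_f_def fun_eq_iff linear_add[OF l] linear_add[OF lh] inner_add_left scaleR_add_left)
  show "connection_f f (\<lambda>P. h P *\<^sub>R X P) Y = (\<lambda>P. h P *\<^sub>R connection_f f X Y P)"
    if "smooth h \<and> smooth X \<and> smooth Y"
    using that
    by (auto simp: connection_f_def fun_eq_iff linear_scale[OF l] linear_scale[OF lh] scaleR_add_right)
  show "connection_f f X (\<lambda>P. Y P + Y' P) = (\<lambda>P. connection_f f X Y P + connection_f f X Y' P)"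
    if "smooth X \<and> smooth Y \<and> smooth Y'"
  proof -
    have "frechet_derivative (\<lambda>P. Y P + Y' P) (at P) =
        (\<lambda>v. frechet_derivative Y (at P) v + frechet_derivative Y' (at P) v)" for P
      using that by (intro frechet_derivative_eqI has_derivative_add smooth_has_derivative) auto
    note d = this
    show ?thesis
      unfolding connection_f_def[abs_def] d
      by (simp add: inner_add_right scaleR_add_left fun_eq_iff algebra_simps)
  qed
  show "connection_f f X (\<lambda>P. h P *\<^sub>R Y P) =
          (\<lambda>P. directional_derivative X h P *\<^sub>R Y P + h P *\<^sub>R connection_f f X Y P)"
    if "smooth h \<and> smooth X \<and> smooth Y"
  proof -
    have "frechet_derivative (\<lambda>P. h P *\<^sub>R Y P) (at P) =
        (\<lambda>v. h P *\<^sub>R frechet_derivative Y (at P) v + frechet_derivative h (at P) v *\<^sub>R Y P)" for P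
      using that by (intro frechet_derivative_eqI has_derivative_scaleR smooth_has_derivative) auto
    note d = this
    show ?thesis
      unfolding connection_f_def[abs_def] d
      by (simp add: scaleR_add_right directional_derivative_def fun_eq_iff)
  qed
qed

text \<open>
  The correction term is symmetric because the Hessian is, and the flat derivative has no torsion.
\<close>
lemma torsion_free_f:
  fixes f :: "real^'p::finite \<Rightarrow> real"
  assumes "smooth f"
  shows "torsion_free (connection_f f)"
  unfolding torsion_free_def
proof (intro allI impI)
  fix X Y :: "(real^'p) \<times> (real^'p) \<Rightarrow> (real^'p) \<times> (real^'p)" and P
  show "connection_f f X Y P - connection_f f Y X P = lie_bracket X Y P"
    unfolding connection_f_def lie_bracket_def directional_derivative_def
      hess_symmetric[OF assms, of "fst P" "fst (X P)" "fst (Y P)"] by simp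
qed

text \<open>
  Differentiating the summand \<open>(grad f \<bullet> Y\<^sub>1) (grad f \<bullet> Z\<^sub>1)\<close> of the metric produces, besides the flat
  derivatives of \<open>Y\<close> and \<open>Z\<close>, the two terms with \<open>H X\<^sub>1 \<bullet> Y\<^sub>1\<close> and \<open>H X\<^sub>1 \<bullet> Z\<^sub>1\<close>.  These are the pairings of
  the vertical corrections with \<open>Z\<close> and \<open>Y\<close>.
\<close>
lemma metric_compatible_f:
  fixes f :: "real^'p::finite \<Rightarrow> real"
  assumes "smooth f"
  shows "metric_compatible (metric_f f) (connection_f f)"
  unfolding metric_compatible_def
proof (intro allI impI)
  fix X Y Z :: "(real^'p) \<times> (real^'p) \<Rightarrow> (real^'p) \<times> (real^'p)" and P
  assume XYZ: "smooth X \<and> smooth Y \<and> smooth Z"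
  then have Y: "(Y has_derivative frechet_derivative Y (at P)) (at P)"
    and Z: "(Z has_derivative frechet_derivative Z (at P)) (at P)"
    by (auto intro: smooth_has_derivative)
  have G: "((\<lambda>P. grad f (fst P)) has_derivative (\<lambda>v. hess f (fst P) (fst v))) (at P)"
    by (rule has_derivative_compose[OF
          bounded_linear_imp_has_derivative[OF bounded_linear_fst] hess_works[OF assms]])
  note Y1 = has_derivative_fst[OF Y] and Y2 = has_derivative_snd[OF Y]
    and Z1 = has_derivative_fst[OF Z] and Z2 = has_derivative_snd[OF Z]
  note dg = has_derivative_add[OF has_derivative_add[OF has_derivative_inner[OF Y1 Z2]
      has_derivative_inner[OF Y2 Z1]]
      has_derivative_mult[OF has_derivative_inner[OF G Y1] has_derivative_inner[OF G Z1]]]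
  show "directional_derivative X (\<lambda>Q. metric_f f Q (Y Q) (Z Q)) P =
      metric_f f P (connection_f f X Y P) (Z P) + metric_f f P (Y P) (connection_f f X Z P)"
    unfolding directional_derivative_def metric_f_eq frechet_derivative_eqI[OF dg]
    by (simp add: connection_f_def inner_add_left inner_add_right algebra_simps inner_commute)
qed

lemma metric_f_nondegenerate:
  assumes "\<And>v. metric_f f P u v = 0"
  shows "u = 0"
proof -
  have "fst u = 0"
    using assms[of "(0, fst u)"] by (simp add: metric_f_eq)
  moreover from this have "snd u = 0"
    using assms[of "(snd u, 0)"] by (simp add: metric_f_eq)
  ultimately show ?thesis by (simp add: prod_eq_iff)
qed

text \<open>
  The choice operator selects some connection with the three properties because \<open>connection_f\<close> has
  them, and uniqueness identifies the two on smooth fields.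
\<close>
lemma levi_civita_metric_f:
  assumes "smooth f" "smooth X" "smooth Y"
  shows "levi_civita (metric_f f) X Y = connection_f f X Y"
proof -
  let ?Q = "\<lambda>D. affine_connection D \<and> torsion_free D \<and> metric_compatible (metric_f f) D"
  have D: "?Q (connection_f f)"
    by (simp add: affine_connection_f torsion_free_f metric_compatible_f assms)
  then have L: "?Q (levi_civita (metric_f f))"
    unfolding levi_civita_def by (rule someI[of ?Q])
  show ?thesis
  proof (rule levi_civita_unique[where g = "metric_f f" and D = "levi_civita (metric_f f)"
        and D' = "connection_f f"])
    show "metric_f f P u v = metric_f f P v u" for P u v
      by (simp add: metric_f_eq inner_commute)
    show "metric_f f P (u - u') v = metric_f f P u v - metric_f f P u' v" for P u u' v
      by (simp add: metric_f_eq inner_diff_left inner_diff_right left_diff_distrib)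
    show "u = 0" if "\<And>v. metric_f f P u v = 0" for P u
      using that by (rule metric_f_nondegenerate)
  qed (use D L assms in blast)+
qed

text \<open>
  For constant fields \<open>\<nabla>\<^sub>v w\<close> is the vertical vector field \<open>(H v\<^sub>1 \<bullet> w\<^sub>1) grad f\<close>, on which \<open>\<nabla>\<^sub>u\<close> acts as
  the flat derivative.  One of the two terms of the product rule contains third derivatives and is
  symmetric in \<open>u, v\<close>; only the other one survives antisymmetrisation.
\<close>
lemma curvature_at_metric_f:
  fixes f :: "real^'p::finite \<Rightarrow> real"
  assumes "smooth f"
  shows "curvature_at (metric_f f) P u v w =
    (0, (hess f (fst P) (fst v) \<bullet> fst w) *\<^sub>R hess f (fst P) (fst u)
      - (hess f (fst P) (fst u) \<bullet> fst w) *\<^sub>R hess f (fst P) (fst v))"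
proof -
  let ?D = "levi_civita (metric_f f)"
  have con: "?D (\<lambda>_. v) (\<lambda>_. w) = connection_f f (\<lambda>_. v) (\<lambda>_. w)" for v w
    by (intro levi_civita_metric_f smooth_const assms)
  have const: "connection_f f (\<lambda>_. v) (\<lambda>_. w) =
      (\<lambda>Q. (0, (hess f (fst Q) (fst v) \<bullet> fst w) *\<^sub>R grad f (fst Q)))" for v w
    by (simp add: connection_f_def fun_eq_iff frechet_derivative_eqI[OF has_derivative_const])
  have "?D (\<lambda>_. u) (?D (\<lambda>_. v) (\<lambda>_. w)) P =
      (0, (hess f (fst P) (fst v) \<bullet> fst w) *\<^sub>R hess f (fst P) (fst u) +
          (frechet_derivative (\<lambda>x. hess f x (fst v)) (at (fst P)) (fst u) \<bullet> fst w) *\<^sub>R grad f (fst P))" for u v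
  proof -
    have sm: "smooth (connection_f f (\<lambda>_. v) (\<lambda>_. w))"
      by (intro smooth_connection_f smooth_const assms)
    have "smooth (\<lambda>x. hess f x (fst v))"
      unfolding hess_def by (intro smooth_intros assms)
    from has_derivative_inner_left[OF smooth_has_derivative[OF this]]
    have h: "((\<lambda>x. hess f x (fst v) \<bullet> fst w) has_derivative
       (\<lambda>a. frechet_derivative (\<lambda>x. hess f x (fst v)) (at x) a \<bullet> fst w)) (at x)" for x .
    have d: "((\<lambda>Q. (0::real^'p, (hess f (fst Q) (fst v) \<bullet> fst w) *\<^sub>R grad f (fst Q))) has_derivative
        (\<lambda>a. (0, (hess f (fst P) (fst v) \<bullet> fst w) *\<^sub>R hess f (fst P) (fst a) +
          (frechet_derivative (\<lambda>x. hess f x (fst v)) (at (fst P)) (fst a) \<bullet> fst w) *\<^sub>R grad f (fst P)))) (at P)"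
      by (intro has_derivative_Pair has_derivative_const)
        (rule has_derivative_compose[OF bounded_linear_imp_has_derivative[OF bounded_linear_fst]
            has_derivative_scaleR[OF h hess_works[OF assms]]])
    show ?thesis
      unfolding con levi_civita_metric_f[OF assms smooth_const sm]
      by (simp add: connection_f_def[of f "\<lambda>_. u"] const frechet_derivative_eqI[OF d])
  qed
  note DD = this
  have "lie_bracket (\<lambda>_. u) (\<lambda>_. v) = (\<lambda>_. 0)"
    by (simp add: lie_bracket_def directional_derivative_def fun_eq_iff
        frechet_derivative_eqI[OF has_derivative_const])
  then have "?D (lie_bracket (\<lambda>_. u) (\<lambda>_. v)) (\<lambda>_. w) P = 0"
    using linear_0[OF linear_hess[OF assms]] by (simp add: con const zero_prod_def)
  note bracket = this
  have "curvature_at (metric_f f) P u v w =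
      ?D (\<lambda>_. u) (?D (\<lambda>_. v) (\<lambda>_. w)) P - ?D (\<lambda>_. v) (?D (\<lambda>_. u) (\<lambda>_. w)) P"
    unfolding curvature_at_def curvature_def Let_def bracket by simp
  then show ?thesis
    unfolding DD hess_derivative_symmetric[OF assms, of "fst v" "fst P" "fst u" "fst w"]
    by simp
qed

section \<open>The Osserman and IP properties\<close>

lemma jacobi_operator_metric_f:
  assumes "smooth f"
  shows "jacobi_operator (metric_f f) P X = vertical (\<lambda>y.
    (hess f (fst P) (fst X) \<bullet> fst X) *\<^sub>R hess f (fst P) y -
    (hess f (fst P) y \<bullet> fst X) *\<^sub>R hess f (fst P) (fst X))"
  by (simp add: jacobi_operator_def vertical_def curvature_at_metric_f[OF assms])

lemma skew_operator_metric_f: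
  assumes "smooth f"
  shows "skew_operator (metric_f f) P X1 X2 = vertical (\<lambda>w.
    (hess f (fst P) (fst X2) \<bullet> w) *\<^sub>R hess f (fst P) (fst X1) -
    (hess f (fst P) (fst X1) \<bullet> w) *\<^sub>R hess f (fst P) (fst X2))"
  by (simp add: skew_operator_def vertical_def curvature_at_metric_f[OF assms])

lemma linear_jacobi:
  assumes "smooth f"
  shows "linear (\<lambda>y. c *\<^sub>R hess f x y - (hess f x y \<bullet> v) *\<^sub>R w)"
  by (auto simp: linear_iff linear_add[OF linear_hess[OF assms]] linear_scale[OF linear_hess[OF assms]]
      algebra_simps inner_add_left)

lemma linear_skew: "linear (\<lambda>w::'a::euclidean_space. (a \<bullet> w) *\<^sub>R b - (c \<bullet> w) *\<^sub>R d)"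
  by (auto simp: linear_iff algebra_simps inner_add_right)

lemma nilpotent_osserman_metric_f: "smooth f \<Longrightarrow> nilpotent_osserman (metric_f f)"
  by (simp add: nilpotent_osserman_def jacobi_operator_metric_f complex_eigenvalues_vertical linear_jacobi)

lemma nilpotent_IP_metric_f: "smooth f \<Longrightarrow> nilpotent_IP (metric_f f)"
  by (auto simp: nilpotent_IP_def skew_operators_def skew_operator_metric_f
      complex_eigenvalues_vertical linear_skew)

lemma orthogonal_pair_independent:
  assumes "metric_f f P e1 e1 \<noteq> 0" "metric_f f P e2 e2 \<noteq> 0" "metric_f f P e1 e2 = 0"
  shows "independent_pair e1 e2"
  unfolding independent_pair_def
proof (intro allI impI)
  fix a b assume Z: "a *\<^sub>R e1 + b *\<^sub>R e2 = 0"
  have lin: "metric_f f P (a *\<^sub>R e1 + b *\<^sub>R e2) W = a * metric_f f P e1 W + b * metric_f f P e2 W" for W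
    by (simp add: metric_f_eq inner_add_left inner_add_right algebra_simps)
  have "metric_f f P e2 e1 = 0"
    using assms(3) by (simp add: metric_f_eq inner_commute algebra_simps)
  then show "a = 0 \<and> b = 0"
    using lin[of e1] lin[of e2] assms unfolding Z by (auto simp: metric_f_eq[of _ _ 0])
qed

text \<open>
  The vertical part enters \<open>(X, X)\<close> linearly through its pairing with \<open>x\<close>, so a suitable multiple of
  \<open>x\<close> gives any prescribed value.
\<close>
lemma metric_f_lift:
  fixes x :: "real^'p::finite"
  assumes "x \<noteq> 0"
  shows "\<exists>X. fst X = x \<and> metric_f f P X X = c"
proof -
  define k where "k = (c - (grad f (fst P) \<bullet> x)\<^sup>2) / (2 * (x \<bullet> x))"
  have "k * (x \<bullet> x) = (c - (grad f (fst P) \<bullet> x)\<^sup>2) / 2"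
    using assms by (simp add: k_def)
  moreover have "metric_f f P (x, k *\<^sub>R x) (x, k *\<^sub>R x) = 2 * (k * (x \<bullet> x)) + (grad f (fst P) \<bullet> x)\<^sup>2"
    by (simp add: metric_f_eq power2_eq_square)
  ultimately have "metric_f f P (x, k *\<^sub>R x) (x, k *\<^sub>R x) = c"
    by simp
  then show ?thesis
    by (intro exI[of _ "(x, k *\<^sub>R x)"]) simp
qed

context
  fixes f :: "real^'p::finite \<Rightarrow> real"
  assumes smooth: "smooth f"
    and nondeg: "\<And>P. nondegenerate_on (form_L f P) distribution_X"
begin

lemmas dim_kernel_jacobi_hess =
  dim_kernel_jacobi[OF linear_hess[OF smooth] hess_symmetric[OF smooth] hess_nondegenerate[OF smooth nondeg]]
lemmas dim_kernel_skew_hess =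
  dim_kernel_skew[OF linear_hess[OF smooth] hess_nondegenerate[OF smooth nondeg]]

text \<open>
  The values \<open>c = 1\<close> and \<open>c = -1\<close> are the spacelike and the timelike case.  A vector with \<open>(X, X) = c \<noteq> 0\<close>
  is not vertical, and in both situations its Jacobi operator comes from a map of the \<open>x\<close>-space with
  one-dimensional kernel.
\<close>
lemma jordan_osserman_metric_f:
  assumes "CARD('p) = 2 \<or> (\<forall>P. definite_on (form_L f P) distribution_X)" and "c \<noteq> 0"
  shows "constant_jordan_form {jacobi_operator (metric_f f) P X | P X. metric_f f P X X = c}"
proof -
  have ker: "dim {y. (hess f x v \<bullet> v) *\<^sub>R hess f x y - (hess f x y \<bullet> v) *\<^sub>R hess f x v = 0} = 1"
    if "v \<noteq> 0" for x v
    using assms(1)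
  proof
    assume "CARD('p) = 2"
    then show ?thesis by (simp add: dim_kernel_jacobi_hess[OF that] del: right_minus_eq)
  next
    assume "\<forall>P. definite_on (form_L f P) distribution_X"
    then have "definite_on (form_L f (x, 0)) distribution_X" by blast
    then have "form_L f (x, 0) (v, 0) (v, 0) \<noteq> 0"
      using that unfolding definite_on_def positive_definite_on_def negative_definite_on_def
      by (auto simp: distribution_X_eq zero_prod_def)
    then show ?thesis
      by (simp add: form_L_eq[OF smooth] dim_kernel_jacobi_hess[OF that] del: right_minus_eq)
  qed
  have nonzero: "fst X \<noteq> 0" if "metric_f f P X X = c" for P X
    using that assms(2) by (auto simp: metric_f_eq)
  show ?thesis
    unfolding constant_jordan_form_def
  proof (intro ballI)
    fix A B
    assume "A \<in> {jacobi_operator (metric_f f) P X | P X. metric_f f P X X = c}"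
      and "B \<in> {jacobi_operator (metric_f f) P X | P X. metric_f f P X X = c}"
    then obtain P X Q Y where A: "A = jacobi_operator (metric_f f) P X" "metric_f f P X X = c"
        and B: "B = jacobi_operator (metric_f f) Q Y" "metric_f f Q Y Y = c"
      by blast
    note X = nonzero[OF A(2)] and Y = nonzero[OF B(2)]
    show "same_jordan_form A B"
      unfolding A(1) B(1) jacobi_operator_metric_f[OF smooth]
        same_jordan_form_vertical[OF linear_jacobi[OF smooth] linear_jacobi[OF smooth]] ker[OF X] ker[OF Y] ..
  qed
qed

text \<open>
  At a single point, lift a vector that is null for the Hessian and one that is not: the Jacobi operators
  of the lifts come from maps of the \<open>x\<close>-space with kernels of dimension \<open>p - 1\<close> and 1.
\<close>
lemma not_jordan_osserman_metric_f:
  assumes "CARD('p) \<ge> 3" and ind: "\<forall>P. indefinite_on (form_L f P) distribution_X"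
  shows "\<not> constant_jordan_form {jacobi_operator (metric_f f) P X | P X. metric_f f P X X = c}"
proof
  assume const: "constant_jordan_form {jacobi_operator (metric_f f) P X | P X. metric_f f P X X = c}"
  obtain u v where uv: "hess f 0 u \<bullet> u > 0" "hess f 0 v \<bullet> v < 0"
    using ind[rule_format, of 0] by (auto simp: indefinite_on_def form_L_eq[OF smooth])
  obtain x where x: "x \<noteq> 0" "hess f 0 x \<bullet> x = 0"
    using indefinite_null_vector[OF linear_hess[OF smooth] hess_symmetric[OF smooth] uv] by blast
  have u: "u \<noteq> 0" using uv by auto
  obtain X where X: "fst X = x" "metric_f f 0 X X = c"
    using metric_f_lift[OF x(1)] by blast
  obtain U where U: "fst U = u" "metric_f f 0 U U = c"
    using metric_f_lift[OF u] by blast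
  have "same_jordan_form (jacobi_operator (metric_f f) 0 X) (jacobi_operator (metric_f f) 0 U)"
    using const X(2) U(2) unfolding constant_jordan_form_def by blast
  then have "dim {y. (hess f 0 x \<bullet> x) *\<^sub>R hess f 0 y - (hess f 0 y \<bullet> x) *\<^sub>R hess f 0 x = 0} =
      dim {y. (hess f 0 u \<bullet> u) *\<^sub>R hess f 0 y - (hess f 0 y \<bullet> u) *\<^sub>R hess f 0 u = 0}"
    unfolding jacobi_operator_metric_f[OF smooth] X(1) U(1) fst_zero
      same_jordan_form_vertical[OF linear_jacobi[OF smooth] linear_jacobi[OF smooth]] .
  then have "CARD('p) - 1 = 1"
    unfolding dim_kernel_jacobi_hess[OF x(1)] dim_kernel_jacobi_hess[OF u] using x(2) uv(1) by simp
  then show False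
    using assms(1) by simp
qed

text \<open>
  \<open>K\<close> stands for the definite planes of either sign: all that matters is that the planes contain no
  null vector.  A combination of \<open>X\<^sub>1, X\<^sub>2\<close> with vanishing \<open>x\<close>-part would be vertical and therefore null,
  so the \<open>x\<close>-parts are independent.
\<close>
lemma jordan_IP_metric_f:
  assumes "\<And>P \<pi> u. K P \<pi> \<Longrightarrow> u \<in> \<pi> \<Longrightarrow> u \<noteq> 0 \<Longrightarrow> metric_f f P u u \<noteq> 0"
  shows "constant_jordan_form (skew_operators (metric_f f) K)"
proof -
  have ind: "independent_pair (fst X1) (fst X2)"
    if K: "K P \<pi>" and ob: "orthonormal_basis (metric_f f) P \<pi> X1 X2" for P \<pi> X1 X2
    unfolding independent_pair_def
  proof (intro allI impI)
    fix a b assume 0: "a *\<^sub>R fst X1 + b *\<^sub>R fst X2 = 0"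
    let ?Z = "a *\<^sub>R X1 + b *\<^sub>R X2"
    have g: "metric_f f P X1 X1 \<in> {1, -1}" "metric_f f P X2 X2 \<in> {1, -1}" "metric_f f P X1 X2 = 0"
      and "span {X1, X2} = \<pi>"
      using ob by (auto simp: orthonormal_basis_def)
    then have "?Z \<in> \<pi>"
      by (auto intro!: span_add span_scale intro: span_base)
    moreover have "metric_f f P ?Z ?Z = 0"
      using 0 by (simp add: metric_f_eq)
    ultimately have "?Z = 0"
      using assms[OF K] by blast
    moreover have "independent_pair X1 X2"
      using g by (intro orthogonal_pair_independent[of f P]) auto
    ultimately show "a = 0 \<and> b = 0"
      unfolding independent_pair_def by blast
  qed
  show ?thesis
    unfolding constant_jordan_form_def
  proof (intro ballI)
    fix A B assume "A \<in> skew_operators (metric_f f) K" "B \<in> skew_operators (metric_f f) K"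
    then obtain P \<pi> X1 X2 Q \<rho> Y1 Y2 where A: "A = skew_operator (metric_f f) P X1 X2"
        and B: "B = skew_operator (metric_f f) Q Y1 Y2"
        and X: "independent_pair (fst X1) (fst X2)" and Y: "independent_pair (fst Y1) (fst Y2)"
      unfolding skew_operators_def using ind by blast
    show "same_jordan_form A B"
      unfolding A B skew_operator_metric_f[OF smooth] same_jordan_form_vertical[OF linear_skew linear_skew]
        dim_kernel_skew_hess[OF X] dim_kernel_skew_hess[OF Y] ..
  qed
qed

text \<open>
  Two mixed planes at the origin are compared.  In the first the basis vectors have the same \<open>x\<close>-part, so
  the curvature operator is zero; in the second the \<open>x\<close>-parts are independent, so it is not.
\<close>
lemma not_mixed_jordan_IP_metric_f:
  assumes "CARD('p) \<ge> 2"
  shows "\<not> mixed_jordan_IP (metric_f f)"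
proof
  let ?g = "metric_f f 0"
  assume mixed: "mixed_jordan_IP (metric_f f)"
  have skew: "skew_operator (metric_f f) 0 e1 e2 \<in> skew_operators (metric_f f) (mixed_plane (metric_f f))"
    if e: "?g e1 e1 = 1" "?g e2 e2 = - 1" "?g e1 e2 = 0" for e1 e2
  proof -
    have "independent_pair e1 e2"
      using e by (intro orthogonal_pair_independent[of f 0]) simp_all
    then have "mixed_plane (metric_f f) 0 (span {e1, e2})"
      unfolding mixed_plane_def two_plane_def using e dim_independent_pair
      by (intro conjI exI[of _ e1] exI[of _ e2]) simp_all
    moreover have "orthonormal_basis (metric_f f) 0 (span {e1, e2}) e1 e2"
      using e by (simp add: orthonormal_basis_def)
    ultimately show ?thesis
      unfolding skew_operators_def by blast
  qed
  have "\<not> CARD('p) \<le> Suc 0"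
    using assms by simp
  then obtain i j :: 'p where ij: "i \<noteq> j"
    by (auto simp: card_le_Suc0_iff_eq)
  define x :: "real^'p" where "x = axis i 1"
  define y :: "real^'p" where "y = axis j 1"
  define s where "s = grad f 0 \<bullet> x"
  define r where "r = grad f 0 \<bullet> y"
  have xy: "x \<bullet> x = 1" "y \<bullet> y = 1" "x \<bullet> y = 0" "y \<bullet> x = 0"
    using ij by (simp_all add: x_def y_def inner_axis_axis)
  \<comment> \<open>\<open>?a\<close> is a spacelike, \<open>?b\<close> and \<open>?c\<close> are timelike unit vectors orthogonal to \<open>?a\<close>.  In the
    vertical part of each, the multiple of its own \<open>x\<close>-part normalises the vector; the term \<open>(s * r) x\<close>
    makes \<open>?c\<close> orthogonal to \<open>?a\<close>.\<close>
  let ?a = "(x, ((1 - s\<^sup>2) / 2) *\<^sub>R x)"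
  let ?b = "(x, ((- 1 - s\<^sup>2) / 2) *\<^sub>R x)"
  let ?c = "(y, ((- 1 - r\<^sup>2) / 2) *\<^sub>R y - (s * r) *\<^sub>R x)"
  have aa: "?g ?a ?a = 1"
    by (simp add: metric_f_eq xy s_def[symmetric] power2_eq_square field_simps)
  have ab: "?g ?b ?b = -1" "?g ?a ?b = 0"
    by (simp_all add: metric_f_eq xy s_def[symmetric] power2_eq_square field_simps)
  have ac: "?g ?c ?c = -1" "?g ?a ?c = 0"
    by (simp_all add: metric_f_eq xy s_def[symmetric] r_def[symmetric] inner_diff_right inner_diff_left power2_eq_square field_simps)
  have "same_jordan_form (skew_operator (metric_f f) 0 ?a ?b) (skew_operator (metric_f f) 0 ?a ?c)"
    using mixed skew[OF aa ab] skew[OF aa ac] unfolding mixed_jordan_IP_def constant_jordan_form_def by blast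
  then have "dim {w. (hess f 0 x \<bullet> w) *\<^sub>R hess f 0 x - (hess f 0 x \<bullet> w) *\<^sub>R hess f 0 x = 0} =
      dim {w. (hess f 0 y \<bullet> w) *\<^sub>R hess f 0 x - (hess f 0 x \<bullet> w) *\<^sub>R hess f 0 y = 0}"
    unfolding skew_operator_metric_f[OF smooth] fst_conv fst_zero
      same_jordan_form_vertical[OF linear_skew linear_skew] .
  moreover have ind: "independent_pair x y"
    unfolding independent_pair_def
  proof (intro allI impI)
    fix a b assume "a *\<^sub>R x + b *\<^sub>R y = 0"
    then have "(a *\<^sub>R x + b *\<^sub>R y) \<bullet> x = 0 \<and> (a *\<^sub>R x + b *\<^sub>R y) \<bullet> y = 0" by simp
    then show "a = 0 \<and> b = 0" by (simp add: inner_add_left xy)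
  qed
  ultimately have "CARD('p) = CARD('p) - 2"
    unfolding dim_kernel_skew_hess[OF ind] by simp
  then show False
    using assms by simp
qed

end

theorem theorem1p3:
  fixes f :: "real^'p::finite \<Rightarrow> real"
  assumes "smooth f"
    and "\<And>P. nondegenerate_on (form_L f P) distribution_X"
  shows
    "(CARD('p) = 2 \<or> (CARD('p) \<ge> 3 \<and> (\<forall>P. definite_on (form_L f P) distribution_X)) \<longrightarrow>
        (nilpotent_osserman (metric_f f) \<and> jordan_osserman (metric_f f)) \<and>
        (nilpotent_IP (metric_f f) \<and> spacelike_jordan_IP (metric_f f) \<and>
           timelike_jordan_IP (metric_f f)) \<and>
        \<not> mixed_jordan_IP (metric_f f)) \<and>
     (CARD('p) \<ge> 3 \<and> (\<forall>P. indefinite_on (form_L f P) distribution_X) \<longrightarrow>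
        (\<not> spacelike_jordan_osserman (metric_f f) \<and> \<not> timelike_jordan_osserman (metric_f f)) \<and>
        (nilpotent_IP (metric_f f) \<and> spacelike_jordan_IP (metric_f f) \<and>
           timelike_jordan_IP (metric_f f)) \<and>
        \<not> mixed_jordan_IP (metric_f f))"
proof -
  have spacelike: "spacelike_jordan_IP (metric_f f)"
    unfolding spacelike_jordan_IP_def
    by (rule jordan_IP_metric_f[OF assms]) (auto simp: spacelike_plane_def positive_definite_on_def)
  have timelike: "timelike_jordan_IP (metric_f f)"
    unfolding timelike_jordan_IP_def
    by (rule jordan_IP_metric_f[OF assms]) (auto simp: timelike_plane_def negative_definite_on_def)
  note IP = nilpotent_IP_metric_f[OF assms(1)] spacelike timelike not_mixed_jordan_IP_metric_f[OF assms]
  have osserman: "jordan_osserman (metric_f f)"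
    if "CARD('p) = 2 \<or> (\<forall>P. definite_on (form_L f P) distribution_X)"
    unfolding jordan_osserman_def spacelike_jordan_osserman_def timelike_jordan_osserman_def
    by (intro conjI jordan_osserman_metric_f[OF assms that]) simp_all
  show ?thesis
    using IP osserman nilpotent_osserman_metric_f[OF assms(1)] not_jordan_osserman_metric_f[OF assms]
    unfolding spacelike_jordan_osserman_def timelike_jordan_osserman_def
    by force
qed

end
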